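(* Let $d_1=d_2=d_3=d\geq 1$, let $\alpha,\beta$ be arbitrary real numbers and let $l\geq 1$ be a natural number. If a tripartite state (density matrix) $\rho$ on $\mathbb{C}^{d_1}\otimes\mathbb{C}^{d_2}\otimes\mathbb{C}^{d_3}$ is biseparable, then $$\mathscr{M}(\rho)\leq\sqrt{(l\alpha^{2}+1)(l\beta^{2}+1)}+\frac{2(d-1)}{3}.$$
   Context: A state is a positive semidefinite complex matrix of trace $1$ on the given space. A tripartite state $\rho$ is biseparable if $$\rho=\sum_i p_i|\varphi_i\rangle^{1|23}\langle\varphi_i|+\sum_j p_j|\varphi_j\rangle^{2|13}\langle\varphi_j|+\sum_k p_k|\varphi_k\rangle^{3|12}\langle\varphi_k|$$ with all $p_i,p_j,p_k\geq 0$, $\sum_i p_i+\sum_j p_j+\sum_k p_k=1$, where $|\varphi\rangle^{a|bc}$ denotes a pure state (unit vector) that is a product across the bipartition $a|bc$, i.e. a tensor product of a vector of subsystem $a$ with a vector of the joint subsystem $bc$. For $A=[a_{ij}]\in\mathbb{C}^{m\times n}$, $\operatorname{vec}(A)=(a_{11},\dots,a_{m1},a_{12},\dots,a_{m2},\dots,a_{1n},\dots,a_{mn})^T$ (column stacking), $T$ denotes transpose (no conjugation), and $\|A\|_{tr}=\operatorname{tr}\sqrt{A^\dagger A}$ is the trace norm. Realignment: if $Z$ is an $m\times m$ block matrix with blocks $Z_{i,j}\in\mathbb{C}^{n\times n}$, then $\mathcal{R}(Z)$ is the $m^2\times n^2$ matrix whose rows are, in order, $\operatorname{vec}(Z_{1,1})^T,\dots,\operatorname{vec}(Z_{m,1})^T,\dots,\operatorname{vec}(Z_{1,m})^T,\dots,\operatorname{vec}(Z_{m,m})^T$.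 For a matrix $X$, $\omega_l(X)=(\operatorname{vec}(X),\dots,\operatorname{vec}(X))$ is the matrix with $l$ columns all equal to $\operatorname{vec}(X)$, and $E_{l\times l}$ is the $l\times l$ all-ones matrix. For a bipartite state $\rho$ on $\mathbb{C}^{d_A}\otimes\mathbb{C}^{d_B}$ (regarded as a $d_A\times d_A$ block matrix with $d_B\times d_B$ blocks), with partial traces $\operatorname{tr}_A,\operatorname{tr}_B$, define $$\mathcal{M}_{\alpha,\beta}^{l}(\rho)=\begin{pmatrix}\alpha\beta E_{l\times l} & \alpha\,\omega_l(\operatorname{tr}_A(\rho))^T\\ \beta\,\omega_l(\operatorname{tr}_B(\rho)) & \mathcal{R}(\rho)\end{pmatrix}.$$ For a tripartite state $\rho$ and $\{i,j,k\}=\{1,2,3\}$, $\mathscr{M}_{i|jk}(\rho)$ is the matrix $\mathcal{M}_{\alpha,\beta}^{l}(\rho)$ obtained by regarding $\rho$ (with tensor factors permuted accordingly) as a bipartite state with $A$ = subsystem $i$ and $B$ = joint subsystem $jk$. Finally $$\mathscr{M}(\rho)=\tfrac13\left(\|\mathscr{M}_{1|23}(\rho)\|_{tr}+\|\mathscr{M}_{2|13}(\rho)\|_{tr}+\|\mathscr{M}_{3|12}(\rho)\|_{tr}\right).$$ *)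

theory Defs
  imports "Jordan_Normal_Form.Schur_Decomposition"
begin

definition mat_trace :: "complex mat \<Rightarrow> complex" where
  "mat_trace A = (\<Sum>i<dim_row A. A $$ (i, i))"

definition psd :: "nat \<Rightarrow> complex mat \<Rightarrow> bool" where
  "psd n A \<longleftrightarrow> A \<in> carrier_mat n n \<and> mat_adjoint A = A \<and>
     (\<forall>v \<in> carrier_vec n. 0 \<le> (A *\<^sub>v v) \<bullet>c v)"

text \<open>The unique positive semidefinite square root; meaningful only for positive
  semidefinite arguments.\<close>

definition psd_sqrt :: "complex mat \<Rightarrow> complex mat" where
  "psd_sqrt A = (THE B. psd (dim_row A) B \<and> B * B = A)"

definition trace_norm :: "complex mat \<Rightarrow> real" where
  "trace_norm A = Re (mat_trace (psd_sqrt (mat_adjoint A * A)))"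

definition state :: "nat \<Rightarrow> complex mat \<Rightarrow> bool" where
  "state n \<rho> \<longleftrightarrow> psd n \<rho> \<and> mat_trace \<rho> = 1"

definition unit_vector :: "complex vec \<Rightarrow> bool" where
  "unit_vector \<phi> \<longleftrightarrow> \<phi> \<bullet>c \<phi> = 1"

definition tensor_vec :: "complex vec \<Rightarrow> complex vec \<Rightarrow> complex vec" where
  "tensor_vec a b = vec (dim_vec a * dim_vec b) (\<lambda>r. a $ (r div dim_vec b) * b $ (r mod dim_vec b))"

text \<open>The standard basis vector with (zero-based) labels \<open>i\<^sub>1, i\<^sub>2, i\<^sub>3\<close> of the three factors, of
  dimensions \<open>d1, d2, d3\<close>, has index \<open>i\<^sub>1 * (d2 * d3) + i\<^sub>2 * d3 + i\<^sub>3\<close>.  The functions below send the index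
  of a basis vector with respect to the reordered factors (2,1,3), respectively (3,1,2), to its index
  with respect to the order (1,2,3).\<close>

definition from_213 :: "nat \<Rightarrow> nat \<Rightarrow> nat \<Rightarrow> nat \<Rightarrow> nat" where
  "from_213 d1 d2 d3 r =
     (let i2 = r div (d1 * d3); i1 = (r div d3) mod d1; i3 = r mod d3
      in i1 * (d2 * d3) + i2 * d3 + i3)"

definition from_312 :: "nat \<Rightarrow> nat \<Rightarrow> nat \<Rightarrow> nat \<Rightarrow> nat" where
  "from_312 d1 d2 d3 r =
     (let i3 = r div (d1 * d2); i1 = (r div d2) mod d1; i2 = r mod d2
      in i1 * (d2 * d3) + i2 * d3 + i3)"

definition reindex_vec :: "(nat \<Rightarrow> nat) \<Rightarrow> complex vec \<Rightarrow> complex vec" where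
  "reindex_vec \<sigma> v = vec (dim_vec v) (\<lambda>r. v $ \<sigma> r)"

definition reindex_mat :: "(nat \<Rightarrow> nat) \<Rightarrow> complex mat \<Rightarrow> complex mat" where
  "reindex_mat \<sigma> A = mat (dim_row A) (dim_col A) (\<lambda>(r, s). A $$ (\<sigma> r, \<sigma> s))"

definition is_tensor :: "nat \<Rightarrow> nat \<Rightarrow> complex vec \<Rightarrow> bool" where
  "is_tensor m n v \<longleftrightarrow> (\<exists>a \<in> carrier_vec m. \<exists>b \<in> carrier_vec n. v = tensor_vec a b)"

definition pure_1_23 :: "nat \<Rightarrow> nat \<Rightarrow> nat \<Rightarrow> complex vec \<Rightarrow> bool" where
  "pure_1_23 d1 d2 d3 \<phi> \<longleftrightarrow> \<phi> \<in> carrier_vec (d1 * d2 * d3) \<and> unit_vector \<phi> \<and>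
     is_tensor d1 (d2 * d3) \<phi>"

definition pure_2_13 :: "nat \<Rightarrow> nat \<Rightarrow> nat \<Rightarrow> complex vec \<Rightarrow> bool" where
  "pure_2_13 d1 d2 d3 \<phi> \<longleftrightarrow> \<phi> \<in> carrier_vec (d1 * d2 * d3) \<and> unit_vector \<phi> \<and>
     is_tensor d2 (d1 * d3) (reindex_vec (from_213 d1 d2 d3) \<phi>)"

definition pure_3_12 :: "nat \<Rightarrow> nat \<Rightarrow> nat \<Rightarrow> complex vec \<Rightarrow> bool" where
  "pure_3_12 d1 d2 d3 \<phi> \<longleftrightarrow> \<phi> \<in> carrier_vec (d1 * d2 * d3) \<and> unit_vector \<phi> \<and>
     is_tensor d3 (d1 * d2) (reindex_vec (from_312 d1 d2 d3) \<phi>)"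

text \<open>The \<open>N \<times> N\<close> matrix \<open>\<Sum>i<n. p i |\<phi> i\<rangle>\<langle>\<phi> i|\<close>, written entrywise because the type of matrices
  of all dimensions has no big sum operator.\<close>

definition mixture :: "nat \<Rightarrow> nat \<Rightarrow> (nat \<Rightarrow> real) \<Rightarrow> (nat \<Rightarrow> complex vec) \<Rightarrow> complex mat" where
  "mixture N n p \<phi> =
     mat N N (\<lambda>(r, s). \<Sum>i<n. complex_of_real (p i) * (\<phi> i $ r * cnj (\<phi> i $ s)))"

definition biseparable :: "nat \<Rightarrow> nat \<Rightarrow> nat \<Rightarrow> complex mat \<Rightarrow> bool" where
  "biseparable d1 d2 d3 \<rho> \<longleftrightarrow>
     (\<exists>n1 n2 n3 p1 p2 p3 \<phi>1 \<phi>2 \<phi>3.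
        (\<forall>i<n1. 0 \<le> p1 i \<and> pure_1_23 d1 d2 d3 (\<phi>1 i)) \<and>
        (\<forall>j<n2. 0 \<le> p2 j \<and> pure_2_13 d1 d2 d3 (\<phi>2 j)) \<and>
        (\<forall>k<n3. 0 \<le> p3 k \<and> pure_3_12 d1 d2 d3 (\<phi>3 k)) \<and>
        (\<Sum>i<n1. p1 i) + (\<Sum>j<n2. p2 j) + (\<Sum>k<n3. p3 k) = 1 \<and>
        \<rho> = mixture (d1 * d2 * d3) n1 p1 \<phi>1 + mixture (d1 * d2 * d3) n2 p2 \<phi>2
              + mixture (d1 * d2 * d3) n3 p3 \<phi>3)"

text \<open>Column stacking.\<close>

definition vectorize :: "complex mat \<Rightarrow> complex vec" where
  "vectorize A = vec (dim_row A * dim_col A) (\<lambda>k. A $$ (k mod dim_row A, k div dim_row A))"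

definition block :: "nat \<Rightarrow> complex mat \<Rightarrow> nat \<Rightarrow> nat \<Rightarrow> complex mat" where
  "block n Z i j = mat n n (\<lambda>(k, l). Z $$ (i * n + k, j * n + l))"

text \<open>The first block index varies fastest along the rows of the realigned matrix.\<close>

definition realign :: "nat \<Rightarrow> nat \<Rightarrow> complex mat \<Rightarrow> complex mat" where
  "realign m n Z = mat (m * m) (n * n) (\<lambda>(r, c). vectorize (block n Z (r mod m) (r div m)) $ c)"

definition tr_A :: "nat \<Rightarrow> nat \<Rightarrow> complex mat \<Rightarrow> complex mat" where
  "tr_A dA dB \<rho> = mat dB dB (\<lambda>(k, l). \<Sum>i<dA. block dB \<rho> i i $$ (k, l))"

definition tr_B :: "nat \<Rightarrow> nat \<Rightarrow> complex mat \<Rightarrow> complex mat" where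
  "tr_B dA dB \<rho> = mat dA dA (\<lambda>(i, j). mat_trace (block dB \<rho> i j))"

definition omega :: "nat \<Rightarrow> complex mat \<Rightarrow> complex mat" where
  "omega l X = mat_of_cols (dim_row X * dim_col X) (replicate l (vectorize X))"

definition all_ones :: "nat \<Rightarrow> complex mat" where
  "all_ones l = mat l l (\<lambda>_. 1)"

definition M_mat ::
    "real \<Rightarrow> real \<Rightarrow> nat \<Rightarrow> nat \<Rightarrow> nat \<Rightarrow> complex mat \<Rightarrow> complex mat" where
  "M_mat \<alpha> \<beta> l dA dB \<rho> = four_block_mat
     (complex_of_real (\<alpha> * \<beta>) \<cdot>\<^sub>m all_ones l)
     (complex_of_real \<alpha> \<cdot>\<^sub>m transpose_mat (omega l (tr_A dA dB \<rho>)))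
     (complex_of_real \<beta> \<cdot>\<^sub>m omega l (tr_B dA dB \<rho>))
     (realign dA dB \<rho>)"

definition M_1_23 ::
    "real \<Rightarrow> real \<Rightarrow> nat \<Rightarrow> nat \<Rightarrow> nat \<Rightarrow> nat \<Rightarrow> complex mat \<Rightarrow> complex mat" where
  "M_1_23 \<alpha> \<beta> l d1 d2 d3 \<rho> = M_mat \<alpha> \<beta> l d1 (d2 * d3) \<rho>"

definition M_2_13 ::
    "real \<Rightarrow> real \<Rightarrow> nat \<Rightarrow> nat \<Rightarrow> nat \<Rightarrow> nat \<Rightarrow> complex mat \<Rightarrow> complex mat" where
  "M_2_13 \<alpha> \<beta> l d1 d2 d3 \<rho> = M_mat \<alpha> \<beta> l d2 (d1 * d3) (reindex_mat (from_213 d1 d2 d3) \<rho>)"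

definition M_3_12 ::
    "real \<Rightarrow> real \<Rightarrow> nat \<Rightarrow> nat \<Rightarrow> nat \<Rightarrow> nat \<Rightarrow> complex mat \<Rightarrow> complex mat" where
  "M_3_12 \<alpha> \<beta> l d1 d2 d3 \<rho> = M_mat \<alpha> \<beta> l d3 (d1 * d2) (reindex_mat (from_312 d1 d2 d3) \<rho>)"

definition M_avg :: "real \<Rightarrow> real \<Rightarrow> nat \<Rightarrow> nat \<Rightarrow> nat \<Rightarrow> nat \<Rightarrow> complex mat \<Rightarrow> real" where
  "M_avg \<alpha> \<beta> l d1 d2 d3 \<rho> =
     1 / 3 * (trace_norm (M_1_23 \<alpha> \<beta> l d1 d2 d3 \<rho>)
            + trace_norm (M_2_13 \<alpha> \<beta> l d1 d2 d3 \<rho>)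
            + trace_norm (M_3_12 \<alpha> \<beta> l d1 d2 d3 \<rho>))"

end

theory Submission
  imports Defs "HOL-Analysis.L2_Norm" "Jordan_Normal_Form.Spectral_Radius"
begin

text \<open>
  If \<open>\<rho>\<close> is a sum of product operators \<open>P\<^sub>t \<otimes> Q\<^sub>t\<close> and has trace one, then \<open>M_mat\<close> of \<open>\<rho>\<close> is the sum
  of the rank one matrices \<open>u\<^sub>t w\<^sub>t\<^sup>T\<close>, where \<open>u\<^sub>t\<close> consists of \<open>l\<close> copies of \<open>\<alpha> tr P\<^sub>t\<close> followed by
  \<open>vec P\<^sub>t\<close>, and \<open>w\<^sub>t\<close> of \<open>l\<close> copies of \<open>\<beta> tr Q\<^sub>t\<close> followed by \<open>vec Q\<^sub>t\<close>. Its trace norm is therefore at most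
  \<open>\<Sum>\<^sub>t |u\<^sub>t| |w\<^sub>t|\<close>. Apply this to \<open>|\<phi>\<rangle>\<langle>\<phi>|\<close>, expanded through a Schmidt decomposition of \<open>\<phi>\<close> with \<open>K\<close>
  terms: the diagonal terms contribute \<open>sqrt ((l \<alpha>\<^sup>2 + 1) (l \<beta>\<^sup>2 + 1))\<close>, the off-diagonal ones at
  most \<open>K - 1\<close>. A vector that is a product across the cut has \<open>K = 1\<close>, any other \<open>K \<le> d\<close>. Each pure
  state of a biseparable mixture is a product across one of the three cuts, so that in the average
  over the cuts it contributes at most \<open>2 (d - 1) / 3\<close> on top of the square root.
\<close>

section \<open>The spectral theorem for Hermitian matrices\<close>

lemma dim_mat_adjoint [simp]:
  "dim_row (mat_adjoint A) = dim_col A" "dim_col (mat_adjoint A) = dim_row A"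
  by (simp_all add: mat_adjoint_def)

lemma mat_adjoint_carrier [simp]: "A \<in> carrier_mat m n \<Longrightarrow> mat_adjoint A \<in> carrier_mat n m"
  by (auto intro: carrier_matI)

lemma index_mat_adjoint [simp]:
  fixes A :: "complex mat"
  shows "i < dim_col A \<Longrightarrow> j < dim_row A \<Longrightarrow> mat_adjoint A $$ (i, j) = cnj (A $$ (j, i))"
  by (simp add: mat_adjoint_def mat_of_rows_index)

lemma index_mult_mat_sum:
  "i < dim_row A \<Longrightarrow> j < dim_col B \<Longrightarrow> dim_col A = dim_row B \<Longrightarrow>
    (A * B) $$ (i, j) = (\<Sum>k<dim_col A. A $$ (i, k) * B $$ (k, j))"
  by (simp add: scalar_prod_def atLeast0LessThan)

lemma mat_adjoint_mult:
  fixes A B :: "complex mat"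
  assumes "dim_col A = dim_row B"
  shows "mat_adjoint (A * B) = mat_adjoint B * mat_adjoint A"
  using assms by (intro eq_matI) (simp_all add: index_mult_mat_sum mult.commute del: index_mult_mat(1))

lemma mat_adjoint_adjoint [simp]: "mat_adjoint (mat_adjoint A) = (A :: complex mat)"
  by (rule eq_matI) auto

lemma mat_adjoint_four_block:
  fixes A B C D :: "complex mat"
  assumes "A \<in> carrier_mat m1 n1" "B \<in> carrier_mat m1 n2" "C \<in> carrier_mat m2 n1" "D \<in> carrier_mat m2 n2"
  shows "mat_adjoint (four_block_mat A B C D) =
    four_block_mat (mat_adjoint A) (mat_adjoint C) (mat_adjoint B) (mat_adjoint D)"
  using assms by (intro eq_matI) auto

lemma mat_adjoint_one [simp]: "mat_adjoint (1\<^sub>m n) = (1\<^sub>m n :: complex mat)"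
  by (rule eq_matI) auto

lemma mat_adjoint_zero [simp]: "mat_adjoint (0\<^sub>m m n) = (0\<^sub>m n m :: complex mat)"
  by (rule eq_matI) auto

lemma cscalar_self: "v \<bullet>c v = complex_of_real (\<Sum>i<dim_vec v. (cmod (v $ i))\<^sup>2)"
  for v :: "complex vec"
  by (simp add: scalar_prod_def atLeast0LessThan complex_mult_cnj cmod_def)

section \<open>Unitary matrices and diagonalisation\<close>

definition unitary :: "nat \<Rightarrow> complex mat \<Rightarrow> bool" where
  "unitary n U \<longleftrightarrow> U \<in> carrier_mat n n \<and> mat_adjoint U * U = 1\<^sub>m n"

lemma unitary_right: "unitary n U \<Longrightarrow> U * mat_adjoint U = 1\<^sub>m n"
  unfolding unitary_def by (metis mat_mult_left_right_inverse mat_adjoint_carrier)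

lemma unitary_mult:
  assumes "unitary n U" "unitary n V"
  shows "unitary n (U * V)"
proof -
  have U: "U \<in> carrier_mat n n" "mat_adjoint U \<in> carrier_mat n n"
    and V: "V \<in> carrier_mat n n" "mat_adjoint V \<in> carrier_mat n n"
    using assms by (auto simp: unitary_def)
  have "mat_adjoint (U * V) * (U * V) = mat_adjoint V * ((mat_adjoint U * U) * V)"
    using U V by (simp add: mat_adjoint_mult assoc_mult_mat[of _ n n _ n _ n])
  also have "\<dots> = 1\<^sub>m n" using assms V by (simp add: unitary_def)
  finally show ?thesis using U V by (simp add: unitary_def)
qed

text \<open>Gram-Schmidt applied to a basis that starts with \<open>v\<close> leaves
  \<open>v\<close> in first place; dividing each column by its norm then gives a unitary matrix,
  with \<open>c\<close> the reciprocal of the norm of \<open>v\<close>.\<close>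

lemma unitary_completion:
  fixes v :: "complex vec"
  assumes v: "v \<in> carrier_vec n" "v \<noteq> 0\<^sub>v n"
  obtains W c where "unitary n W" "col W 0 = c \<cdot>\<^sub>v v"
proof -
  interpret cof_vec_space n "TYPE(complex)" .
  let ?b = "basis_completion v"
  note b = basis_completion[OF v]
  define ws where "ws = gram_schmidt n ?b"
  have corth: "corthogonal ws" and wsc: "set ws \<subseteq> carrier_vec n" and len: "length ws = n"
    using gram_schmidt_result[OF _ _ _ ws_def] b by auto
  have n: "0 < n" using v by (cases n) auto
  then obtain vs where "?b = v # vs" using b by (cases ?b) auto
  then have hd: "ws ! 0 = v" using len n gram_schmidt_hd[OF v(1), of vs]
    by (subst hd_conv_nth[symmetric]) (auto simp: ws_def)
  have wi: "ws ! i \<in> carrier_vec n" if "i < n" for i using that wsc len by auto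
  define nr where "nr i = sqrt (\<Sum>k<n. (cmod (ws ! i $ k))\<^sup>2)" for i
  have nr2: "ws ! i \<bullet>c ws ! i = complex_of_real (nr i) * complex_of_real (nr i)" if "i < n" for i
    using wi[OF that] by (subst cscalar_self) (auto simp: nr_def sum_nonneg simp flip: of_real_mult)
  have nr0: "nr i \<noteq> 0" if "i < n" for i
    using corthogonalD[OF corth, of i i] nr2[OF that] that len by auto
  define W where "W = mat n n (\<lambda>(k, i). ws ! i $ k / complex_of_real (nr i))"
  have "mat_adjoint W * W = 1\<^sub>m n"
  proof (rule eq_matI)
    fix i j assume "i < dim_row (1\<^sub>m n :: complex mat)" "j < dim_col (1\<^sub>m n :: complex mat)"
    then have ij: "i < n" "j < n" by auto
    have "(mat_adjoint W * W) $$ (i, j) = (\<Sum>k<n. cnj (W $$ (k, i)) * W $$ (k, j))"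
      using ij by (subst index_mult_mat_sum) (auto simp: W_def)
    also have "\<dots> = (\<Sum>k<n. ws ! j $ k * cnj (ws ! i $ k)) / (complex_of_real (nr i) * complex_of_real (nr j))"
      using ij by (simp add: W_def sum_divide_distrib mult.commute)
    also have "(\<Sum>k<n. ws ! j $ k * cnj (ws ! i $ k)) = ws ! j \<bullet>c ws ! i"
      using wi[OF ij(1)] wi[OF ij(2)] by (auto simp: scalar_prod_def atLeast0LessThan)
    also have "\<dots> / (complex_of_real (nr i) * complex_of_real (nr j)) = 1\<^sub>m n $$ (i, j)"
      using ij corthogonalD[OF corth, of j i] len nr2[of i] nr0[of i] by auto
    finally show "(mat_adjoint W * W) $$ (i, j) = 1\<^sub>m n $$ (i, j)" .
  qed (auto simp: W_def)
  then have "unitary n W" by (auto simp: unitary_def W_def)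
  moreover have "col W 0 = (1 / complex_of_real (nr 0)) \<cdot>\<^sub>v v"
    using n v hd by (intro eq_vecI) (auto simp: W_def)
  ultimately show thesis by (rule that)
qed

text \<open>Deflation: in a unitary basis that starts with an eigenvector, \<open>A\<close> splits
  into the eigenvalue and a Hermitian block of size one less, to which the induction hypothesis
  applies. The \<open>d i\<close> are not claimed to be real here; the applications that need this
  obtain it from positivity or from squared norms.\<close>

theorem hermitian_spectral:
  assumes "A \<in> carrier_mat n n" "mat_adjoint A = A"
  shows "\<exists>U d. unitary n U \<and> mat_adjoint U * A * U = mat n n (\<lambda>(i, j). if i = j then d i else 0)"
  using assms
proof (induction n arbitrary: A)
  case 0
  then show ?case by (intro exI[of _ "1\<^sub>m 0"] exI) (auto simp: unitary_def intro!: eq_matI)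
next
  case (Suc n)
  from spectrum_non_empty[OF Suc.prems(1)] obtain e v where
    "eigenvector A v e" by (auto simp: spectrum_def eigenvalue_def)
  then have v: "v \<in> carrier_vec (Suc n)" "v \<noteq> 0\<^sub>v (Suc n)" "A *\<^sub>v v = e \<cdot>\<^sub>v v"
    using Suc.prems by (auto simp: eigenvector_def)
  obtain W c where W: "unitary (Suc n) W" "col W 0 = c \<cdot>\<^sub>v v"
    using unitary_completion[OF v(1,2)] by blast
  have Wc: "W \<in> carrier_mat (Suc n) (Suc n)" "mat_adjoint W \<in> carrier_mat (Suc n) (Suc n)"
    and WW: "mat_adjoint W * W = 1\<^sub>m (Suc n)"
    using W by (auto simp: unitary_def)
  note Ac = Suc.prems(1)
  define B where "B = mat_adjoint W * A * W"
  have Bc: "B \<in> carrier_mat (Suc n) (Suc n)" using Wc Ac by (auto simp: B_def)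
  have Bh: "mat_adjoint B = B"
    using Wc Ac Suc.prems(2) by (simp add: B_def mat_adjoint_mult assoc_mult_mat[of _ "Suc n" "Suc n" _ "Suc n" _ "Suc n"])
  have colAW: "col (A * W) 0 = e \<cdot>\<^sub>v col W 0"
    using W(2) v Ac Wc by (subst col_mult2[OF Ac Wc(1)]) (auto simp: mult_mat_vec smult_smult_assoc mult.commute)
  have B0: "B $$ (i, 0) = (if i = 0 then e else 0)" if "i < Suc n" for i
  proof -
    have "B $$ (i, 0) = row (mat_adjoint W) i \<bullet> col (A * W) 0"
      using that Wc Ac by (simp add: B_def assoc_mult_mat[of _ "Suc n" "Suc n" _ "Suc n" _ "Suc n"])
    also have "\<dots> = e * (mat_adjoint W * W) $$ (i, 0)"
      using that Wc by (simp add: colAW)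
    finally show ?thesis using that by (simp add: WW)
  qed
  \<comment> \<open>Hermitian symmetry carries the zeros of the first column over to the first
    row.\<close>
  have B0': "B $$ (0, i) = (if i = 0 then e else 0)" if "i < Suc n" for i
  proof -
    have "B $$ (0, i) = cnj (B $$ (i, 0))" using Bc that by (subst Bh[symmetric]) simp
    then show ?thesis using B0[OF that] B0[of 0] Bh Bc that
      by (auto split: if_splits)
  qed
  define A3 where "A3 = mat n n (\<lambda>(i, j). B $$ (Suc i, Suc j))"
  have A3c: "A3 \<in> carrier_mat n n" by (simp add: A3_def)
  have "cnj (B $$ (i, j)) = B $$ (j, i)" if "i < Suc n" "j < Suc n" for i j
    using Bc that by (subst (2) Bh[symmetric]) simp
  then have "mat_adjoint A3 = A3"
    by (intro eq_matI) (auto simp: A3_def)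
  from Suc.IH[OF A3c this] obtain V d where V: "unitary n V"
    and Vd: "mat_adjoint V * A3 * V = mat n n (\<lambda>(i, j). if i = j then d i else 0)" by blast
  have Vc: "V \<in> carrier_mat n n" "mat_adjoint V \<in> carrier_mat n n" using V by (auto simp: unitary_def)
  \<comment> \<open>Bordered by a one, \<open>V\<close> acts on the trailing block only and fixes
    the eigenvector already split off.\<close>
  define F where "F = four_block_mat (1\<^sub>m 1) (0\<^sub>m 1 n) (0\<^sub>m n 1) V"
  have Fa: "mat_adjoint F = four_block_mat (1\<^sub>m 1) (0\<^sub>m 1 n) (0\<^sub>m n 1) (mat_adjoint V)"
    unfolding F_def by (subst mat_adjoint_four_block[of _ 1 1 _ n _ n]) (use Vc in auto)
  have Fc: "F \<in> carrier_mat (Suc n) (Suc n)" "mat_adjoint F \<in> carrier_mat (Suc n) (Suc n)"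
    unfolding Fa unfolding F_def using Vc by auto
  have "mat_adjoint F * F = 1\<^sub>m (Suc n)"
    unfolding Fa unfolding F_def
    by (subst mult_four_block_mat[of _ 1 1 _ n _ n _ _ 1 _ n]) (use V Vc in \<open>auto simp: unitary_def\<close>)
  then have F: "unitary (Suc n) F" using Fc by (simp add: unitary_def)
  have Bblock: "B = four_block_mat (mat 1 1 (\<lambda>_. e)) (0\<^sub>m 1 n) (0\<^sub>m n 1) A3"
    using Bc B0 B0' by (intro eq_matI) (auto simp: A3_def)
  have "mat_adjoint (W * F) * A * (W * F) = mat_adjoint F * B * F"
    using Wc Fc Ac by (simp add: B_def mat_adjoint_mult assoc_mult_mat[of _ "Suc n" "Suc n" _ "Suc n" _ "Suc n"]
        mult_carrier_mat[of _ "Suc n" "Suc n" _ "Suc n"])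
  also have "\<dots> = four_block_mat (mat 1 1 (\<lambda>_. e)) (0\<^sub>m 1 n) (0\<^sub>m n 1) (mat_adjoint V * A3 * V)"
    unfolding Fa Bblock unfolding F_def
    using Vc A3c
    by (simp add: mult_four_block_mat[of _ 1 1 _ n _ n _ _ 1 _ n] mult_carrier_mat[of _ n n _ n])
  also have "\<dots> = mat (Suc n) (Suc n) (\<lambda>(i, j). if i = j then (case i of 0 \<Rightarrow> e | Suc k \<Rightarrow> d k) else 0)"
    unfolding Vd by (intro eq_matI) (auto split: nat.split)
  finally show ?case using unitary_mult[OF W(1) F] by blast
qed

section \<open>The trace norm of a sum of rank one matrices\<close>

text \<open>Vectors are functions of which only the values below \<open>n\<close> count, so that
  matrix columns, bordered vectors and tensor factors can be used as they are. Linear in the first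
  argument, conjugate linear in the second.\<close>

definition cinner :: "nat \<Rightarrow> (nat \<Rightarrow> complex) \<Rightarrow> (nat \<Rightarrow> complex) \<Rightarrow> complex" where
  "cinner n f g = (\<Sum>i<n. f i * cnj (g i))"

definition l2norm :: "nat \<Rightarrow> (nat \<Rightarrow> complex) \<Rightarrow> real" where
  "l2norm n f = L2_set (\<lambda>i. cmod (f i)) {..<n}"

lemma l2norm_nonneg [simp]: "0 \<le> l2norm n f"
  by (simp add: l2norm_def)

lemma l2norm_sq: "(l2norm n f)\<^sup>2 = (\<Sum>i<n. (cmod (f i))\<^sup>2)"
  by (simp add: l2norm_def L2_set_def sum_nonneg)

lemma cinner_self: "cinner n f f = complex_of_real ((l2norm n f)\<^sup>2)"
  by (simp add: cinner_def l2norm_sq complex_mult_cnj cmod_def)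

lemma cnj_cinner: "cnj (cinner n f g) = cinner n g f"
  by (simp add: cinner_def mult.commute)

lemma cinner_sum_right:
  "cinner n f (\<lambda>i. \<Sum>k\<in>K. c k * g k i) = (\<Sum>k\<in>K. cnj (c k) * cinner n f (g k))"
  unfolding cinner_def by (simp add: sum_distrib_left mult.left_commute) (rule sum.swap)

lemma sum_mult_le_l2norm: "cmod (\<Sum>i<n. f i * g i) \<le> l2norm n f * l2norm n g"
proof -
  have "cmod (\<Sum>i<n. f i * g i) \<le> (\<Sum>i<n. \<bar>cmod (f i)\<bar> * \<bar>cmod (g i)\<bar>)"
    by (rule order_trans[OF norm_sum]) (simp add: norm_mult)
  also have "\<dots> \<le> l2norm n f * l2norm n g"
    unfolding l2norm_def by (rule L2_set_mult_ineq)
  finally show ?thesis .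
qed

lemma l2norm_cnj [simp]: "l2norm n (\<lambda>i. cnj (f i)) = l2norm n f"
  by (simp add: l2norm_def)

lemma cinner_le_l2norm: "cmod (cinner n f g) \<le> l2norm n f * l2norm n g"
  using sum_mult_le_l2norm[where g = "\<lambda>i. cnj (g i)"] by (simp add: cinner_def)

text \<open>The norms are only bounded by one because a left singular vector is computed as \<open>A v / s\<close>,
  which is \<open>0\<close> for the singular value \<open>s = 0\<close>.\<close>

lemma bessel:
  assumes orth: "\<And>j k. j < K \<Longrightarrow> k < K \<Longrightarrow> j \<noteq> k \<Longrightarrow> cinner n (g j) (g k) = 0"
    and le: "\<And>k. k < K \<Longrightarrow> l2norm n (g k) \<le> 1"
  shows "l2norm K (\<lambda>k. cinner n u (g k)) \<le> l2norm n u"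
proof -
  define c where "c k = cinner n u (g k)" for k
  \<comment> \<open>As the \<open>g k\<close> need not be normalised, \<open>p\<close> need not be
    the orthogonal projection of \<open>u\<close>. Still the square of its norm is at most
    \<open>?S\<close>, and \<open>?S\<close> is the inner product of \<open>u\<close> and
    \<open>p\<close>; Cauchy-Schwarz then bounds the root of \<open>?S\<close> by the norm of
    \<open>u\<close>.\<close>
  define p where "p i = (\<Sum>k<K. c k * g k i)" for i
  let ?S = "(l2norm K c)\<^sup>2"
  have up: "cinner n u p = complex_of_real ?S"
    unfolding p_def cinner_sum_right l2norm_sq c_def[symmetric]
    by (simp add: complex_mult_cnj cmod_def mult.commute)
  have cp: "cinner n p (g k) = c k * complex_of_real ((l2norm n (g k))\<^sup>2)" if "k < K" for k
  proof -
    have "cinner n p (g k) = cnj (\<Sum>j<K. cnj (c j) * cinner n (g k) (g j))"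
      unfolding p_def cinner_sum_right[symmetric] by (simp add: cnj_cinner)
    also have "\<dots> = (\<Sum>j<K. if j = k then c k * cinner n (g k) (g k) else 0)"
      unfolding cnj_sum using that by (intro sum.cong) (auto simp: orth cnj_cinner)
    also have "\<dots> = c k * complex_of_real ((l2norm n (g k))\<^sup>2)"
      using that by (simp add: cinner_self)
    finally show ?thesis .
  qed
  have "cinner n p p = (\<Sum>k<K. cnj (c k) * cinner n p (g k))"
    unfolding p_def[abs_def] by (rule cinner_sum_right)
  also have "\<dots> = complex_of_real (\<Sum>k<K. (cmod (c k))\<^sup>2 * (l2norm n (g k))\<^sup>2)"
    unfolding of_real_sum by (intro sum.cong) (auto simp: cp complex_norm_square simp flip: of_real_power)
  finally have "(l2norm n p)\<^sup>2 = (\<Sum>k<K. (cmod (c k))\<^sup>2 * (l2norm n (g k))\<^sup>2)"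
    unfolding cinner_self of_real_eq_iff .
  also have "\<dots> \<le> (\<Sum>k<K. (cmod (c k))\<^sup>2 * 1)"
    using le by (intro sum_mono mult_left_mono) (auto simp: power_le_one)
  finally have "(l2norm n p)\<^sup>2 \<le> ?S" by (simp add: l2norm_sq)
  then have pS: "l2norm n p \<le> l2norm K c" by (rule power2_le_imp_le) simp
  have "?S = cmod (cinner n u p)" unfolding up by (simp add: norm_power)
  also have "\<dots> \<le> l2norm n u * l2norm n p" by (rule cinner_le_l2norm)
  also have "\<dots> \<le> l2norm n u * l2norm K c" using pS by (simp add: mult_left_mono)
  finally have "l2norm K c * l2norm K c \<le> l2norm n u * l2norm K c" by (simp add: power2_eq_square)
  then have "l2norm K c \<le> l2norm n u"
    using l2norm_nonneg[of n u] by (cases "l2norm K c = 0") (auto simp: less_le)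
  then show ?thesis by (simp add: c_def[abs_def])
qed

section \<open>Uniqueness of the positive semidefinite square root\<close>

lemma cscalar_mat_adjoint:
  fixes A :: "complex mat"
  assumes "A \<in> carrier_mat m n" "v \<in> carrier_vec n" "w \<in> carrier_vec m"
  shows "(A *\<^sub>v v) \<bullet>c w = v \<bullet>c (mat_adjoint A *\<^sub>v w)"
proof -
  have "(A *\<^sub>v v) \<bullet>c w = (\<Sum>i<m. \<Sum>j<n. A $$ (i, j) * v $ j * cnj (w $ i))"
    using assms by (simp add: scalar_prod_def atLeast0LessThan sum_distrib_right)
  also have "\<dots> = (\<Sum>j<n. \<Sum>i<m. A $$ (i, j) * v $ j * cnj (w $ i))"
    by (rule sum.swap)
  also have "\<dots> = v \<bullet>c (mat_adjoint A *\<^sub>v w)"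
    using assms by (simp add: scalar_prod_def atLeast0LessThan sum_distrib_left mult_ac)
  finally show ?thesis .
qed

text \<open>Since (C + b)(C - b) v = 0, the residual w = C v - b v satisfies C w = - b w. Positivity
  of \<open>C\<close> makes both b |w|^2 and its negative nonnegative, so w vanishes unless b = 0.
  If b = 0, then w = C v and C w = 0, and moving \<open>C\<close> across the inner product gives
  |w|^2 = 0.\<close>

lemma psd_sqrt_eigen:
  assumes C: "psd n C" and v: "v \<in> carrier_vec n" and b: "0 \<le> (b :: complex)"
    and eq: "C *\<^sub>v (C *\<^sub>v v) = (b * b) \<cdot>\<^sub>v v"
  shows "C *\<^sub>v v = b \<cdot>\<^sub>v v"
proof -
  have Cc: "C \<in> carrier_mat n n" and Ch: "mat_adjoint C = C"
    and Cp: "\<And>v. v \<in> carrier_vec n \<Longrightarrow> 0 \<le> (C *\<^sub>v v) \<bullet>c v"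
    using C by (auto simp: psd_def)
  define w where "w = C *\<^sub>v v - b \<cdot>\<^sub>v v"
  have Cv: "C *\<^sub>v v \<in> carrier_vec n" using Cc v by auto
  have w: "w \<in> carrier_vec n" using Cv v by (auto simp: w_def)
  have Cw: "C *\<^sub>v w = (- b) \<cdot>\<^sub>v w"
    using Cc v Cv unfolding w_def
    by (simp add: mult_minus_distrib_mat_vec[of _ n n] mult_mat_vec[of _ n n] eq)
       (auto intro!: eq_vecI simp: algebra_simps)
  have pos: "0 \<le> w \<bullet>c w"
    unfolding cscalar_self by (simp add: less_eq_complex_def sum_nonneg del: of_real_sum)
  have "0 \<le> - (b * (w \<bullet>c w))"
    using Cp[OF w] w by (simp add: Cw)
  moreover have "0 \<le> b * (w \<bullet>c w)" using pos b by simp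
  ultimately have bw: "b * (w \<bullet>c w) = 0" by (simp add: less_eq_complex_def complex_eq_iff)
  have "w \<bullet>c w = 0"
  proof (cases "b = 0")
    case True
    have "w = C *\<^sub>v v" using True Cc v unfolding w_def by (intro eq_vecI) auto
    then have "w \<bullet>c w = (C *\<^sub>v v) \<bullet>c w" by simp
    also have "\<dots> = v \<bullet>c (C *\<^sub>v w)" using cscalar_mat_adjoint[OF Cc v w] by (simp add: Ch)
    also have "C *\<^sub>v w = 0\<^sub>v n" using True w unfolding Cw by (intro eq_vecI) auto
    also have "v \<bullet>c 0\<^sub>v n = 0" using v by simp
    finally show ?thesis .
  qed (use bw in simp)
  then have "w = 0\<^sub>v n" using conjugate_square_eq_0_vec[OF w] by simp
  then have "w $ i = 0" if "i < n" for i using that by simp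
  then show ?thesis using Cc Cv v by (intro eq_vecI) (auto simp: w_def)
qed

text \<open>An eigenvector of \<open>B\<close> for the eigenvalue \<open>d k\<close> is one of
  \<open>C * C\<close> for the square of \<open>d k\<close>, hence one of \<open>C\<close> for
  \<open>d k\<close> itself. Thus \<open>B\<close> and \<open>C\<close> agree on an orthonormal
  basis.\<close>

lemma psd_sqrt_unique:
  assumes B: "psd n B" and C: "psd n C" and eq: "B * B = C * C"
  shows "B = C"
proof -
  have Bc: "B \<in> carrier_mat n n" and Cc: "C \<in> carrier_mat n n" using B C by (auto simp: psd_def)
  obtain U d where U: "unitary n U"
    and d: "mat_adjoint U * B * U = mat n n (\<lambda>(i, j). if i = j then d i else 0)"
    using hermitian_spectral[OF Bc] B by (auto simp: psd_def)
  let ?D = "mat n n (\<lambda>(i, j). if i = j then d i else 0)"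
  have Uc: "U \<in> carrier_mat n n" "mat_adjoint U \<in> carrier_mat n n" and UU: "mat_adjoint U * U = 1\<^sub>m n"
    using U by (auto simp: unitary_def)
  note UU' = unitary_right[OF U]
  have BU: "B * U = U * ?D"
  proof -
    have "U * ?D = (U * mat_adjoint U) * (B * U)"
      unfolding d[symmetric] using Uc Bc by (simp add: assoc_mult_mat[of _ n n _ n _ n] mult_carrier_mat[of _ n n _ n])
    then show ?thesis using Uc Bc by (simp add: UU')
  qed
  have Bv: "B *\<^sub>v col U k = d k \<cdot>\<^sub>v col U k" if k: "k < n" for k
  proof -
    have "B *\<^sub>v col U k = col (U * ?D) k"
      unfolding BU[symmetric] col_mult2[OF Bc Uc(1) k] ..
    also have "\<dots> = d k \<cdot>\<^sub>v col U k"
      using Uc k by (intro eq_vecI) (auto simp: index_mult_mat_sum if_distrib mult.commute cong: if_cong simp del: index_mult_mat(1))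
    finally show ?thesis .
  qed
  have Cv: "C *\<^sub>v col U k = d k \<cdot>\<^sub>v col U k" if k: "k < n" for k
  proof (rule psd_sqrt_eigen[OF C])
    show v: "col U k \<in> carrier_vec n" using Uc k by auto
    have "col U k \<bullet>c col U k = (mat_adjoint U * U) $$ (k, k)"
      using Uc k by (simp add: index_mult_mat_sum scalar_prod_def atLeast0LessThan mult.commute del: index_mult_mat(1))
    then have one: "col U k \<bullet>c col U k = 1" using k by (simp add: UU)
    \<comment> \<open>At a unit eigenvector the quadratic form of \<open>B\<close> equals the
      eigenvalue.\<close>
    have "0 \<le> (B *\<^sub>v col U k) \<bullet>c col U k" using B v by (auto simp: psd_def)
    then show "0 \<le> d k" using v by (simp add: Bv[OF k] one)
    have "C *\<^sub>v (C *\<^sub>v col U k) = B *\<^sub>v (B *\<^sub>v col U k)"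
      using assoc_mult_mat_vec[OF Bc Bc v] assoc_mult_mat_vec[OF Cc Cc v] eq by simp
    also have "\<dots> = (d k * d k) \<cdot>\<^sub>v col U k"
      using Bc v by (simp add: Bv[OF k] mult_mat_vec[of _ n n] smult_smult_assoc)
    finally show "C *\<^sub>v (C *\<^sub>v col U k) = (d k * d k) \<cdot>\<^sub>v col U k" .
  qed
  have "col (C * U) k = col (B * U) k" if k: "k < n" for k
    unfolding col_mult2[OF Bc Uc(1) k] col_mult2[OF Cc Uc(1) k] Bv[OF k] Cv[OF k] ..
  then have "C * U = B * U"
    by (intro mat_col_eqI) (use Bc Cc Uc in auto)
  then have "C * (U * mat_adjoint U) = B * (U * mat_adjoint U)"
    using assoc_mult_mat[OF Bc Uc] assoc_mult_mat[OF Cc Uc] by simp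
  then show ?thesis using Bc Cc by (simp add: UU')
qed

text \<open>Evaluates the definite description behind \<open>psd_sqrt\<close>: any positive
  semidefinite root that is exhibited is the right one.\<close>

lemma psd_sqrt_eq: "psd n B \<Longrightarrow> psd_sqrt (B * B) = B"
  unfolding psd_sqrt_def
  by (rule the_equality) (auto simp: psd_def intro: psd_sqrt_unique[of n])

section \<open>The trace norm through singular values\<close>

lemma mat_trace_comm:
  assumes "A \<in> carrier_mat m n" "B \<in> carrier_mat n m"
  shows "mat_trace (A * B) = mat_trace (B * A)"
proof -
  have "mat_trace (A * B) = (\<Sum>i<m. \<Sum>j<n. A $$ (i, j) * B $$ (j, i))"
    using assms by (simp add: mat_trace_def index_mult_mat_sum del: index_mult_mat(1))
  also have "\<dots> = (\<Sum>j<n. \<Sum>i<m. A $$ (i, j) * B $$ (j, i))"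
    by (rule sum.swap)
  also have "\<dots> = mat_trace (B * A)"
    using assms by (simp add: mat_trace_def index_mult_mat_sum mult.commute del: index_mult_mat(1))
  finally show ?thesis .
qed

text \<open>In the coordinates x of \<open>v\<close> with respect to the columns of
  \<open>U\<close>, the quadratic form is the sum of s_k |x_k|^2.\<close>

lemma psd_unitary_conjugate:
  assumes U: "unitary n U" and s: "\<And>k. k < n \<Longrightarrow> 0 \<le> s k"
  shows "psd n (U * mat n n (\<lambda>(i, j). if i = j then complex_of_real (s i) else 0) * mat_adjoint U)"
    (is "psd n (U * ?S * mat_adjoint U)")
proof -
  have Uc: "U \<in> carrier_mat n n" "mat_adjoint U \<in> carrier_mat n n"
    using U by (auto simp: unitary_def)
  have Sc: "?S \<in> carrier_mat n n" by simp
  have "mat_adjoint ?S = ?S" by (rule eq_matI) auto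
  then have adj: "mat_adjoint (U * ?S * mat_adjoint U) = U * ?S * mat_adjoint U"
    using Uc by (simp add: mat_adjoint_mult assoc_mult_mat[OF Uc(1) Sc Uc(2)])
  have "0 \<le> (U * ?S * mat_adjoint U *\<^sub>v v) \<bullet>c v" if v: "v \<in> carrier_vec n" for v
  proof -
    let ?x = "mat_adjoint U *\<^sub>v v"
    have x: "?x \<in> carrier_vec n" "?S *\<^sub>v ?x \<in> carrier_vec n"
      using mult_mat_vec_carrier[OF Uc(2) v] mult_mat_vec_carrier[OF Sc] by auto
    have Sx: "(?S *\<^sub>v ?x) $ k = complex_of_real (s k) * ?x $ k" if "k < n" for k
    proof -
      have "(?S *\<^sub>v ?x) $ k = (\<Sum>j<n. (if k = j then complex_of_real (s k) else 0) * ?x $ j)"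
        using that x(1) Uc by (simp add: scalar_prod_def atLeast0LessThan del: index_mult_mat_vec)
          (simp add: scalar_prod_def atLeast0LessThan)
      then show ?thesis using that by (simp add: if_distrib[of "\<lambda>z. z * _"] cong: if_cong)
    qed
    have "(U * ?S * mat_adjoint U *\<^sub>v v) \<bullet>c v = (U *\<^sub>v (?S *\<^sub>v ?x)) \<bullet>c v"
      using Uc Sc v x by (simp add: assoc_mult_mat_vec[of _ n n _ n])
    also have "\<dots> = (?S *\<^sub>v ?x) \<bullet>c ?x"
      by (rule cscalar_mat_adjoint[OF Uc(1) x(2) v])
    also have "\<dots> = (\<Sum>k<n. complex_of_real (s k * (cmod (?x $ k))\<^sup>2))"
      using Uc unfolding scalar_prod_def
      by (auto simp: atLeast0LessThan Sx complex_mult_cnj cmod_def mult.assoc simp del: index_mult_mat_vec intro!: sum.cong)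
    finally show ?thesis
      using s by (auto simp: less_eq_complex_def intro!: sum_nonneg mult_nonneg_nonneg)
  qed
  then show ?thesis using Uc adj by (auto simp: psd_def)
qed

text \<open>The trace norm is the sum of the singular values s_k, and each s_k is the inner product
  of \<open>A\<close> applied to a right singular vector with the matching left one. Inserting the
  rank one expansion of \<open>A\<close> turns the sum over k into one bilinear expression per term
  i, bounded by Cauchy-Schwarz; Bessel's inequality for the left and the right singular vectors then
  leaves the norms of \<open>u i\<close> and \<open>w i\<close>.\<close>

theorem trace_norm_le_sum:
  assumes A: "A \<in> carrier_mat m n"
    and entries: "\<And>r c. r < m \<Longrightarrow> c < n \<Longrightarrow> A $$ (r, c) = (\<Sum>i\<in>I. u i r * w i c)"
  shows "trace_norm A \<le> (\<Sum>i\<in>I. l2norm m (u i) * l2norm n (w i))"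
proof -
  define H where "H = mat_adjoint A * A"
  have Hc: "H \<in> carrier_mat n n" using A by (auto simp: H_def)
  have Hh: "mat_adjoint H = H" using A by (simp add: H_def mat_adjoint_mult)
  obtain U d where U: "unitary n U"
    and d: "mat_adjoint U * H * U = mat n n (\<lambda>(i, j). if i = j then d i else 0)"
    using hermitian_spectral[OF Hc Hh] by blast
  have Uc: "U \<in> carrier_mat n n" "mat_adjoint U \<in> carrier_mat n n" and UU: "mat_adjoint U * U = 1\<^sub>m n"
    using U by (auto simp: unitary_def)
  note UU' = unitary_right[OF U]
  \<comment> \<open>The columns of \<open>U\<close> are right singular vectors, so those of
    \<open>A * U\<close> are pairwise orthogonal and their norms \<open>s k\<close> are the singular
    values.\<close>
  define G where "G = A * U"
  have Gc: "G \<in> carrier_mat m n" using A Uc by (auto simp: G_def)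
  have Ac: "mat_adjoint A \<in> carrier_mat n m" using A by simp
  have GG: "mat_adjoint G * G = mat n n (\<lambda>(i, j). if i = j then d i else 0)"
    unfolding d[symmetric] H_def G_def using A Ac Uc
    by (simp add: mat_adjoint_mult assoc_mult_mat[of _ n m _ n _ n] assoc_mult_mat[of _ n n _ m _ n] assoc_mult_mat[of _ n n _ n _ n]
        mult_carrier_mat[of _ n m _ n] mult_carrier_mat[of _ m n _ n])
  define s where "s k = l2norm m (\<lambda>r. G $$ (r, k))" for k
  have cG: "cinner m (\<lambda>r. G $$ (r, j)) (\<lambda>r. G $$ (r, k)) = (if k = j then d k else 0)"
    if "j < n" "k < n" for j k
  proof -
    have "cinner m (\<lambda>r. G $$ (r, j)) (\<lambda>r. G $$ (r, k)) = (mat_adjoint G * G) $$ (k, j)"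
      using that Gc by (simp add: cinner_def index_mult_mat_sum mult.commute del: index_mult_mat(1))
    then show ?thesis using that by (simp add: GG)
  qed
  have ds: "d k = complex_of_real (s k) * complex_of_real (s k)" if "k < n" for k
    using cG[OF that that] by (simp add: cinner_self s_def power2_eq_square)
  let ?S = "mat n n (\<lambda>(i, j). if i = j then complex_of_real (s i) else 0)"
  \<comment> \<open>The candidate for the square root of \<open>H\<close>: the same eigenvectors,
    with the roots \<open>s k\<close> of the eigenvalues \<open>d k\<close>.\<close>
  let ?B = "U * ?S * mat_adjoint U"
  have Sc: "?S \<in> carrier_mat n n" by simp
  have SS: "?S * ?S = mat_adjoint U * H * U"
    unfolding d by (intro eq_matI)
      (auto simp: index_mult_mat_sum ds if_distrib[of "\<lambda>z. z * _"] simp del: index_mult_mat(1) cong: if_cong)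
  have "?B * ?B = U * ?S * ((mat_adjoint U * U) * (?S * mat_adjoint U))"
    using Uc Sc by (simp add: assoc_mult_mat[of _ n n _ n _ n] mult_carrier_mat[of _ n n _ n])
  also have "\<dots> = U * (?S * ?S) * mat_adjoint U"
    unfolding UU using Uc Sc by (simp add: assoc_mult_mat[of _ n n _ n _ n] mult_carrier_mat[of _ n n _ n])
  also have "\<dots> = (U * mat_adjoint U) * H * (U * mat_adjoint U)"
    unfolding SS using Uc Hc by (simp add: assoc_mult_mat[of _ n n _ n _ n] mult_carrier_mat[of _ n n _ n])
  also have "\<dots> = H" unfolding UU' using Hc by simp
  finally have BB: "?B * ?B = H" .
  have "psd n ?B" by (rule psd_unitary_conjugate[OF U]) (simp add: s_def)
  from psd_sqrt_eq[OF this] have "psd_sqrt H = ?B" unfolding BB .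
  then have "trace_norm A = Re (mat_trace ?B)" by (simp add: trace_norm_def H_def)
  also have "mat_trace ?B = mat_trace (mat_adjoint U * (U * ?S))"
    using Uc by (intro mat_trace_comm[of _ n n]) auto
  also have "mat_adjoint U * (U * ?S) = ?S"
    using assoc_mult_mat[OF Uc(2,1) Sc] by (simp add: UU)
  also have "Re (mat_trace ?S) = (\<Sum>k<n. s k)"
    by (simp add: mat_trace_def)
  finally have tn: "trace_norm A = (\<Sum>k<n. s k)" .
  define g where "g k r = G $$ (r, k) / complex_of_real (s k)" for k r
  \<comment> \<open>The conjugation under \<open>cinner\<close> cancels the one written here, so
    \<open>z i k\<close> is the plain bilinear pairing of \<open>w i\<close> with column k of
    \<open>U\<close>.\<close>
  define z where "z i k = cinner n (w i) (\<lambda>c. cnj (U $$ (c, k)))" for i k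
  have sk: "complex_of_real (s k) = (\<Sum>i\<in>I. cinner m (u i) (g k) * z i k)" if k: "k < n" for k
  proof -
    \<comment> \<open>For \<open>s k = 0\<close> both sides are zero, because division by zero
      yields zero.\<close>
    have "complex_of_real (s k) = cinner m (\<lambda>r. G $$ (r, k)) (\<lambda>r. G $$ (r, k)) / complex_of_real (s k)"
      using cG[OF k k] ds[OF k] by simp
    also have "\<dots> = (\<Sum>r<m. G $$ (r, k) * cnj (g k r))"
      by (simp add: cinner_def g_def sum_divide_distrib)
    also have "\<dots> = (\<Sum>r<m. \<Sum>i\<in>I. u i r * cnj (g k r) * z i k)"
    proof (rule sum.cong[OF refl])
      fix r assume "r \<in> {..<m}"
      then have r: "r < m" by simp
      have "G $$ (r, k) = (\<Sum>c<n. \<Sum>i\<in>I. u i r * w i c * U $$ (c, k))"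
        using r k A Uc by (simp add: G_def index_mult_mat_sum entries sum_distrib_right del: index_mult_mat(1))
      also have "\<dots> = (\<Sum>i\<in>I. u i r * z i k)"
        by (subst sum.swap) (simp add: z_def cinner_def sum_distrib_left mult.assoc)
      finally show "G $$ (r, k) * cnj (g k r) = (\<Sum>i\<in>I. u i r * cnj (g k r) * z i k)"
        by (simp add: sum_distrib_left sum_distrib_right mult_ac)
    qed
    also have "\<dots> = (\<Sum>i\<in>I. cinner m (u i) (g k) * z i k)"
      by (subst sum.swap) (simp add: cinner_def sum_distrib_right)
    finally show ?thesis .
  qed
  have "complex_of_real (trace_norm A) = (\<Sum>k<n. \<Sum>i\<in>I. cinner m (u i) (g k) * z i k)"
    by (simp add: tn sk)
  also have "\<dots> = (\<Sum>i\<in>I. \<Sum>k<n. cinner m (u i) (g k) * z i k)"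
    by (rule sum.swap)
  finally have eq: "complex_of_real (trace_norm A) = (\<Sum>i\<in>I. \<Sum>k<n. cinner m (u i) (g k) * z i k)" .
  have "trace_norm A \<le> cmod (complex_of_real (trace_norm A))" by simp
  also have "\<dots> \<le> (\<Sum>i\<in>I. cmod (\<Sum>k<n. cinner m (u i) (g k) * z i k))"
    unfolding eq by (rule norm_sum)
  also have "\<dots> \<le> (\<Sum>i\<in>I. l2norm n (\<lambda>k. cinner m (u i) (g k)) * l2norm n (z i))"
    by (intro sum_mono sum_mult_le_l2norm)
  also have "\<dots> \<le> (\<Sum>i\<in>I. l2norm m (u i) * l2norm n (w i))"
  proof (intro sum_mono mult_mono)
    fix i
    show "l2norm n (\<lambda>k. cinner m (u i) (g k)) \<le> l2norm m (u i)"
    proof (rule bessel)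
      fix j k assume jk: "j < n" "k < n" "j \<noteq> k"
      have "cinner m (g j) (g k) = cinner m (\<lambda>r. G $$ (r, j)) (\<lambda>r. G $$ (r, k)) /
          (complex_of_real (s j) * complex_of_real (s k))"
        by (simp add: g_def cinner_def sum_divide_distrib)
      then show "cinner m (g j) (g k) = 0"
        using cG jk by simp
    next
      fix k assume "k < n"
      have "(l2norm m (g k))\<^sup>2 = (s k)\<^sup>2 / (s k)\<^sup>2"
        unfolding s_def[of k] l2norm_sq sum_divide_distrib
        by (intro sum.cong) (simp_all add: g_def norm_divide power_divide s_def l2norm_sq)
      also have "\<dots> \<le> 1\<^sup>2" by simp
      finally show "l2norm m (g k) \<le> 1" by (rule power2_le_imp_le) simp
    qed
    have cU: "cinner n (\<lambda>c. cnj (U $$ (c, j))) (\<lambda>c. cnj (U $$ (c, k))) = (if j = k then 1 else 0)"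
      if "j < n" "k < n" for j k
    proof -
      have "cinner n (\<lambda>c. cnj (U $$ (c, j))) (\<lambda>c. cnj (U $$ (c, k))) = (mat_adjoint U * U) $$ (j, k)"
        using that Uc by (simp add: cinner_def index_mult_mat_sum del: index_mult_mat(1))
      then show ?thesis using that by (simp add: UU)
    qed
    show "l2norm n (z i) \<le> l2norm n (w i)"
      unfolding z_def[abs_def]
    proof (rule bessel)
      fix k assume k: "k < n"
      have "complex_of_real ((l2norm n (\<lambda>c. cnj (U $$ (c, k))))\<^sup>2) = complex_of_real 1"
        using cU[OF k k] by (simp only: cinner_self) simp
      then have "(l2norm n (\<lambda>c. cnj (U $$ (c, k))))\<^sup>2 = 1" unfolding of_real_eq_iff .
      then show "l2norm n (\<lambda>c. cnj (U $$ (c, k))) \<le> 1"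
        by (auto simp: power2_eq_1_iff)
    qed (simp add: cU)
  qed simp_all
  finally show ?thesis .
qed

section \<open>The matrix of a sum of product operators\<close>

lemma mult_add_less:
  fixes i j m n :: nat
  assumes "i < m" "j < n"
  shows "i * n + j < m * n"
proof -
  have "i * n + j < Suc i * n" using assms by simp
  also have "\<dots> \<le> m * n" using assms by (intro mult_le_mono1) simp
  finally show ?thesis .
qed

lemma sum_pairs_div_mod:
  fixes f :: "nat \<Rightarrow> nat \<Rightarrow> 'a :: comm_monoid_add"
  shows "(\<Sum>r<m * n. f (r div n) (r mod n)) = (\<Sum>i<m. \<Sum>j<n. f i j)"
proof -
  have "r mod n < n" if "r < m * n" for r
    using that by (cases n) auto
  then have "(\<Sum>r<m * n. f (r div n) (r mod n)) = (\<Sum>(i, j)\<in>{..<m} \<times> {..<n}. f i j)"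
    by (intro sum.reindex_bij_witness[of _ "\<lambda>(i, j). i * n + j" "\<lambda>r. (r div n, r mod n)"])
       (auto simp: mult_add_less less_mult_imp_div_less)
  then show ?thesis by (simp add: sum.cartesian_product)
qed

lemma omega_index:
  assumes "X \<in> carrier_mat a b" "r < a * b" "c < l"
  shows "omega l X $$ (r, c) = X $$ (r mod a, r div a)"
  using assms by (simp add: omega_def mat_of_cols_index vectorize_def)

lemma omega_carrier: "X \<in> carrier_mat a b \<Longrightarrow> omega l X \<in> carrier_mat (a * b) l"
  unfolding omega_def by (intro carrier_matI) auto

lemma mod_div_less_square:
  fixes r n :: nat
  assumes "r < n * n"
  shows "r mod n < n" "r div n < n"
  using assms by (auto simp: less_mult_imp_div_less intro!: mod_less_divisor Nat.gr0I)

text \<open>The row encodes the two block indices and the column the two inner ones, each with the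
  first index varying fastest. Hence a product P \<otimes> Q is realigned to the rank one matrix
  with entries vec(P)_r vec(Q)_c.\<close>

lemma realign_index:
  assumes "r < m * m" "c < n * n"
  shows "realign m n Z $$ (r, c) = Z $$ ((r mod m) * n + c mod n, (r div m) * n + c div n)"
  using assms mod_div_less_square[OF assms(2)]
  by (simp add: realign_def vectorize_def block_def)

lemma M_mat_carrier: "M_mat \<alpha> \<beta> l m n Z \<in> carrier_mat (l + m * m) (l + n * n)"
  by (auto simp: M_mat_def all_ones_def realign_def intro!: carrier_matI)

text \<open>\<open>M_mat\<close> is linear up to its constant corner \<open>\<alpha> \<beta> E\<close>, which fits because the trace is one.\<close>

lemma M_mat_entry:
  fixes P :: "'t \<Rightarrow> nat \<Rightarrow> nat \<Rightarrow> complex" and Q :: "'t \<Rightarrow> nat \<Rightarrow> nat \<Rightarrow> complex"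
  assumes entries: "\<And>i j i' j'. i < m \<Longrightarrow> j < n \<Longrightarrow> i' < m \<Longrightarrow> j' < n \<Longrightarrow>
      Z $$ (i * n + j, i' * n + j') = (\<Sum>t\<in>T. P t i i' * Q t j j')"
    and one: "(\<Sum>t\<in>T. (\<Sum>i<m. P t i i) * (\<Sum>j<n. Q t j j)) = 1"
    and r: "r < l + m * m" and c: "c < l + n * n"
  shows "M_mat \<alpha> \<beta> l m n Z $$ (r, c) =
    (\<Sum>t\<in>T. (if r < l then complex_of_real \<alpha> * (\<Sum>i<m. P t i i) else P t ((r - l) mod m) ((r - l) div m)) *
         (if c < l then complex_of_real \<beta> * (\<Sum>j<n. Q t j j) else Q t ((c - l) mod n) ((c - l) div n)))"
    (is "_ = (\<Sum>t\<in>T. ?u t * ?w t)")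
proof -
  have A: "tr_A m n Z \<in> carrier_mat n n" and B: "tr_B m n Z \<in> carrier_mat m m"
    by (auto simp: tr_A_def tr_B_def)
  note oA = omega_carrier[OF A, of l] and oB = omega_carrier[OF B, of l]
  have trA: "tr_A m n Z $$ (j, j') = (\<Sum>t\<in>T. (\<Sum>i<m. P t i i) * Q t j j')" if "j < n" "j' < n" for j j'
  proof -
    have "tr_A m n Z $$ (j, j') = (\<Sum>i<m. \<Sum>t\<in>T. P t i i * Q t j j')"
      using that by (simp add: tr_A_def block_def entries)
    also have "\<dots> = (\<Sum>t\<in>T. (\<Sum>i<m. P t i i) * Q t j j')"
      by (subst sum.swap) (simp add: sum_distrib_right)
    finally show ?thesis .
  qed
  have trB: "tr_B m n Z $$ (i, i') = (\<Sum>t\<in>T. P t i i' * (\<Sum>j<n. Q t j j))" if "i < m" "i' < m" for i i'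
  proof -
    have "tr_B m n Z $$ (i, i') = (\<Sum>j<n. \<Sum>t\<in>T. P t i i' * Q t j j)"
      using that by (simp add: tr_B_def block_def mat_trace_def entries)
    also have "\<dots> = (\<Sum>t\<in>T. P t i i' * (\<Sum>j<n. Q t j j))"
      by (subst sum.swap) (simp add: sum_distrib_left)
    finally show ?thesis .
  qed
  \<comment> \<open>The upper right block is a transpose, hence the swapped arguments of
    \<open>omega\<close> there.\<close>
  have M: "M_mat \<alpha> \<beta> l m n Z $$ (r, c) =
     (if r < l then
        if c < l then complex_of_real (\<alpha> * \<beta>) else complex_of_real \<alpha> * omega l (tr_A m n Z) $$ (c - l, r)
      else if c < l then complex_of_real \<beta> * omega l (tr_B m n Z) $$ (r - l, c)
      else realign m n Z $$ (r - l, c - l))"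
    using r c oA oB by (auto simp: M_mat_def all_ones_def realign_def)
  show ?thesis
  proof (cases "r < l")
    case rl: True
    show ?thesis
    proof (cases "c < l")
      case True
      have "M_mat \<alpha> \<beta> l m n Z $$ (r, c) =
          complex_of_real \<alpha> * complex_of_real \<beta> * (\<Sum>t\<in>T. (\<Sum>i<m. P t i i) * (\<Sum>j<n. Q t j j))"
        unfolding M using rl True by (simp add: one)
      also have "\<dots> = (\<Sum>t\<in>T. ?u t * ?w t)"
        unfolding sum_distrib_left[of "_ * _"] using rl True by (intro sum.cong) simp_all
      finally show ?thesis .
    next
      case False
      then have c': "c - l < n * n" using c by simp
      have "M_mat \<alpha> \<beta> l m n Z $$ (r, c) =
          complex_of_real \<alpha> * (\<Sum>t\<in>T. (\<Sum>i<m. P t i i) * Q t ((c - l) mod n) ((c - l) div n))"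
        unfolding M using rl False c' mod_div_less_square[OF c'] by (simp add: omega_index[OF A] trA)
      also have "\<dots> = (\<Sum>t\<in>T. ?u t * ?w t)"
        unfolding sum_distrib_left[of "complex_of_real \<alpha>" _ T] using rl False by (intro sum.cong) simp_all
      finally show ?thesis .
    qed
  next
    case rl: False
    then have r': "r - l < m * m" using r by simp
    note rm = mod_div_less_square[OF r']
    show ?thesis
    proof (cases "c < l")
      case True
      have "M_mat \<alpha> \<beta> l m n Z $$ (r, c) =
          complex_of_real \<beta> * (\<Sum>t\<in>T. P t ((r - l) mod m) ((r - l) div m) * (\<Sum>j<n. Q t j j))"
        unfolding M using rl True r' rm by (simp add: omega_index[OF B] trB)
      also have "\<dots> = (\<Sum>t\<in>T. ?u t * ?w t)"
        unfolding sum_distrib_left[of "complex_of_real \<beta>" _ T] using rl True by (intro sum.cong) simp_all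
      finally show ?thesis .
    next
      case False
      then have c': "c - l < n * n" using c by simp
      show ?thesis
        unfolding M using rl False r' c' rm mod_div_less_square[OF c']
        by (simp add: realign_index entries)
    qed
  qed
qed

section \<open>Norms of the bordered vectors\<close>

lemma sum_lessThan_add:
  fixes f :: "nat \<Rightarrow> 'a :: comm_monoid_add"
  shows "(\<Sum>r<a + b. f r) = (\<Sum>r<a. f r) + (\<Sum>r<b. f (a + r))"
  by (induction b) (simp_all add: add.assoc)

text \<open>The vector is \<open>l\<close> copies of \<open>a\<close> followed by the stacked
  columns of \<open>Q\<close>; the tail contributes the squared Frobenius norm of
  \<open>Q\<close>.\<close>

lemma l2norm_bordered:
  "l2norm (l + n * n) (\<lambda>r. if r < l then a else Q ((r - l) mod n) ((r - l) div n)) =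
    sqrt (real l * (cmod a)\<^sup>2 + (\<Sum>i<n. \<Sum>j<n. (cmod (Q i j))\<^sup>2))"
proof -
  let ?f = "\<lambda>r. if r < l then a else Q ((r - l) mod n) ((r - l) div n)"
  have "(l2norm (l + n * n) ?f)\<^sup>2 = (\<Sum>r<l. (cmod (?f r))\<^sup>2) + (\<Sum>r<n * n. (cmod (?f (l + r)))\<^sup>2)"
    unfolding l2norm_sq by (rule sum_lessThan_add)
  also have "(\<Sum>r<l. (cmod (?f r))\<^sup>2) = real l * (cmod a)\<^sup>2"
    by simp
  also have "(\<Sum>r<n * n. (cmod (?f (l + r)))\<^sup>2) = (\<Sum>r<n * n. (cmod (Q (r mod n) (r div n)))\<^sup>2)"
    by simp
  also have "\<dots> = (\<Sum>j<n. \<Sum>i<n. (cmod (Q i j))\<^sup>2)"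
    using sum_pairs_div_mod[of "\<lambda>j i. (cmod (Q i j))\<^sup>2" n n] by simp
  also have "\<dots> = (\<Sum>i<n. \<Sum>j<n. (cmod (Q i j))\<^sup>2)"
    by (rule sum.swap)
  finally show ?thesis
    by (simp add: real_sqrt_unique)
qed

text \<open>The index type of the terms stays polymorphic because they are later labelled by a pure
  state together with two Schmidt indices.\<close>

lemma trace_norm_M_mat_le:
  fixes P :: "'t \<Rightarrow> nat \<Rightarrow> nat \<Rightarrow> complex" and Q :: "'t \<Rightarrow> nat \<Rightarrow> nat \<Rightarrow> complex"
  assumes entries: "\<And>i j i' j'. i < m \<Longrightarrow> j < n \<Longrightarrow> i' < m \<Longrightarrow> j' < n \<Longrightarrow>
      Z $$ (i * n + j, i' * n + j') = (\<Sum>t\<in>T. P t i i' * Q t j j')"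
    and one: "(\<Sum>t\<in>T. (\<Sum>i<m. P t i i) * (\<Sum>j<n. Q t j j)) = 1"
  shows "trace_norm (M_mat \<alpha> \<beta> l m n Z) \<le>
    (\<Sum>t\<in>T. sqrt (real l * (cmod (complex_of_real \<alpha> * (\<Sum>i<m. P t i i)))\<^sup>2 + (\<Sum>i<m. \<Sum>i'<m. (cmod (P t i i'))\<^sup>2)) *
         sqrt (real l * (cmod (complex_of_real \<beta> * (\<Sum>j<n. Q t j j)))\<^sup>2 + (\<Sum>j<n. \<Sum>j'<n. (cmod (Q t j j'))\<^sup>2)))"
  unfolding l2norm_bordered[symmetric]
  by (rule trace_norm_le_sum[OF M_mat_carrier M_mat_entry[OF entries one]])

section \<open>Schmidt decompositions\<close>

text \<open>Translates the unit norm of \<phi> into the trace condition on the product terms and,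
  once orthogonality is available, into the normalisation of the Schmidt coefficients.\<close>

lemma cinner_tensor_sum:
  assumes dec: "\<And>i j. i < m \<Longrightarrow> j < n \<Longrightarrow> \<phi> (i * n + j) = (\<Sum>k<K. x k i * y k j)"
  shows "cinner (m * n) \<phi> \<phi> = (\<Sum>k<K. \<Sum>k'<K. cinner m (x k) (x k') * cinner n (y k) (y k'))"
proof -
  have "cinner (m * n) \<phi> \<phi> =
      (\<Sum>r<m * n. (\<lambda>i j. \<phi> (i * n + j) * cnj (\<phi> (i * n + j))) (r div n) (r mod n))"
    by (simp add: cinner_def)
  also have "\<dots> = (\<Sum>i<m. \<Sum>j<n. \<phi> (i * n + j) * cnj (\<phi> (i * n + j)))"
    by (rule sum_pairs_div_mod)
  also have "\<dots> = (\<Sum>i<m. \<Sum>j<n. \<Sum>k<K. \<Sum>k'<K. (x k i * cnj (x k' i)) * (y k j * cnj (y k' j)))"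
    by (intro sum.cong refl) (simp add: dec sum_product mult_ac)
  also have "\<dots> = (\<Sum>k<K. \<Sum>k'<K. \<Sum>i<m. \<Sum>j<n. (x k i * cnj (x k' i)) * (y k j * cnj (y k' j)))"
    by (simp only: sum.swap[of _ "{..<K}" "{..<n}"] sum.swap[of _ "{..<K}" "{..<m}"])
  also have "\<dots> = (\<Sum>k<K. \<Sum>k'<K. cinner m (x k) (x k') * cinner n (y k) (y k'))"
    by (simp add: cinner_def sum_product)
  finally show ?thesis .
qed

lemma l2norm_mult_sq:
  "(l2norm m f * l2norm n g)\<^sup>2 = (\<Sum>i<m. \<Sum>j<n. (cmod (f i))\<^sup>2 * (cmod (g j))\<^sup>2)"
  by (simp add: power_mult_distrib l2norm_sq sum_product)

lemma sum_squared_le_card: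
  fixes a :: "nat \<Rightarrow> real"
  shows "(\<Sum>k<K. a k)\<^sup>2 \<le> real K * (\<Sum>k<K. (a k)\<^sup>2)"
proof -
  have "\<bar>\<Sum>k<K. a k\<bar> \<le> (\<Sum>k<K. \<bar>1\<bar> * \<bar>a k\<bar>)"
    by simp
  also have "\<dots> \<le> L2_set (\<lambda>_. 1) {..<K} * L2_set a {..<K}"
    by (rule L2_set_mult_ineq)
  finally have "(\<Sum>k<K. a k)\<^sup>2 \<le> (L2_set (\<lambda>_. 1) {..<K} * L2_set a {..<K})\<^sup>2"
    by (metis abs_ge_zero power2_abs power_mono)
  then show ?thesis
    by (simp add: L2_set_def power_mult_distrib sum_nonneg)
qed

text \<open>The diagonal terms of a Schmidt decomposition add up to at most the bound for product vectors,
  the off-diagonal ones to \<open>(\<Sum>k a k)\<^sup>2 - 1 \<le> K - 1\<close> where \<open>\<Sum>k (a k)\<^sup>2 = 1\<close>.\<close>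

lemma schmidt_terms_le:
  fixes x y :: "nat \<Rightarrow> nat \<Rightarrow> complex"
  defines "B n z c k k' \<equiv> sqrt (c * (cmod (cinner n (z k) (z k')))\<^sup>2 + (l2norm n (z k) * l2norm n (z k'))\<^sup>2)"
  assumes ox: "\<And>k k'. k < K \<Longrightarrow> k' < K \<Longrightarrow> k \<noteq> k' \<Longrightarrow> cinner m (x k) (x k') = 0"
    and oy: "\<And>k k'. k < K \<Longrightarrow> k' < K \<Longrightarrow> k \<noteq> k' \<Longrightarrow> cinner n (y k) (y k') = 0"
    and one: "(\<Sum>k<K. (l2norm m (x k) * l2norm n (y k))\<^sup>2) = 1"
    and c: "0 \<le> a" "0 \<le> b"
  shows "(\<Sum>k<K. \<Sum>k'<K. B m x a k k' * B n y b k k') \<le> sqrt ((a + 1) * (b + 1)) + (real K - 1)"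
proof -
  define S where "S = sqrt ((a + 1) * (b + 1))"
  have S: "S = sqrt (a + 1) * sqrt (b + 1)" by (simp only: S_def real_sqrt_mult)
  define s where "s k = l2norm m (x k) * l2norm n (y k)" for k
  have diag: "B n z c k k = sqrt (c + 1) * (l2norm n (z k))\<^sup>2" for n z c k
  proof -
    have "c * (cmod (cinner n (z k) (z k)))\<^sup>2 + (l2norm n (z k) * l2norm n (z k))\<^sup>2 =
        (c + 1) * ((l2norm n (z k))\<^sup>2)\<^sup>2"
      unfolding cinner_self norm_of_real by (simp add: power2_eq_square algebra_simps)
    then show ?thesis unfolding B_def by (simp only: real_sqrt_mult real_sqrt_abs) simp
  qed
  \<comment> \<open>Off the diagonal the inner products vanish and only the norms remain. On the
    diagonal the product is \<open>S\<close> times the square of \<open>s k\<close>, written as an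
    excess over \<open>s k * s k\<close> so that the full double sum becomes a square.\<close>
  have "B m x a k k' * B n y b k k' = s k * s k' + (if k' = k then (S - 1) * (s k)\<^sup>2 else 0)"
    if "k < K" "k' < K" for k k'
  proof (cases "k' = k")
    case True
    then show ?thesis
      by (simp add: diag S s_def power2_eq_square algebra_simps)
  next
    case False
    then show ?thesis using that ox[of k k'] oy[of k k']
      by (simp add: B_def s_def)
  qed
  then have "(\<Sum>k<K. \<Sum>k'<K. B m x a k k' * B n y b k k') =
      (\<Sum>k<K. \<Sum>k'<K. s k * s k' + (if k' = k then (S - 1) * (s k)\<^sup>2 else 0))"
    by simp
  also have "\<dots> = (\<Sum>k<K. s k)\<^sup>2 + (S - 1) * (\<Sum>k<K. (s k)\<^sup>2)"
  proof -
    have "(\<Sum>k<K. s k)\<^sup>2 = (\<Sum>k<K. \<Sum>k'<K. s k * s k')"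
      by (simp add: power2_eq_square sum_product)
    then show ?thesis by (simp add: sum.distrib sum_distrib_left)
  qed
  also have "\<dots> \<le> real K * (\<Sum>k<K. (s k)\<^sup>2) + (S - 1) * (\<Sum>k<K. (s k)\<^sup>2)"
    using sum_squared_le_card[of s K] by simp
  also have "\<dots> = S + (real K - 1)"
    using one by (simp add: s_def)
  finally show ?thesis by (simp add: S_def)
qed

text \<open>The coefficients are absorbed into the vectors, which are orthogonal but not normalised
  and may vanish. So \<open>K\<close> is only an upper bound for the Schmidt rank.\<close>

definition schmidt ::
    "nat \<Rightarrow> nat \<Rightarrow> nat \<Rightarrow> (nat \<Rightarrow> complex) \<Rightarrow> (nat \<Rightarrow> nat \<Rightarrow> complex) \<Rightarrow> (nat \<Rightarrow> nat \<Rightarrow> complex) \<Rightarrow> bool"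
  where "schmidt m n K \<phi> x y \<longleftrightarrow>
     (\<forall>i<m. \<forall>j<n. \<phi> (i * n + j) = (\<Sum>k<K. x k i * y k j)) \<and>
     (\<forall>k<K. \<forall>k'<K. k \<noteq> k' \<longrightarrow> cinner m (x k) (x k') = 0) \<and>
     (\<forall>k<K. \<forall>k'<K. k \<noteq> k' \<longrightarrow> cinner n (y k) (y k') = 0)"

text \<open>Each projector onto \<phi> expands into the products |x_k><x_k'| \<otimes> |y_k><y_k'|.
  The terms of all pure states are gathered into one family before estimating, so that the total
  trace one accounts for the constant corner of \<open>M_mat\<close>.\<close>

lemma trace_norm_M_mat_mixture_le:
  fixes p :: "'t \<Rightarrow> real" and \<phi> :: "'t \<Rightarrow> nat \<Rightarrow> complex"
  assumes T: "finite T"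
    and entries: "\<And>r s. r < m * n \<Longrightarrow> s < m * n \<Longrightarrow>
      Z $$ (r, s) = (\<Sum>t\<in>T. complex_of_real (p t) * (\<phi> t r * cnj (\<phi> t s)))"
    and p: "\<And>t. t \<in> T \<Longrightarrow> 0 \<le> p t" "(\<Sum>t\<in>T. p t) = 1"
    and unit: "\<And>t. t \<in> T \<Longrightarrow> l2norm (m * n) (\<phi> t) = 1"
    and schmidt: "\<And>t. t \<in> T \<Longrightarrow> \<exists>x y. schmidt m n (K t) (\<phi> t) x y"
  shows "trace_norm (M_mat \<alpha> \<beta> l m n Z) \<le>
    (\<Sum>t\<in>T. p t * (sqrt ((real l * \<alpha>\<^sup>2 + 1) * (real l * \<beta>\<^sup>2 + 1)) + (real (K t) - 1)))"
proof -
  from schmidt obtain x y where xy: "\<And>t. t \<in> T \<Longrightarrow> schmidt m n (K t) (\<phi> t) (x t) (y t)"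
    by metis
  have dec: "\<phi> t (i * n + j) = (\<Sum>k<K t. x t k i * y t k j)" if "t \<in> T" "i < m" "j < n" for t i j
    using xy[OF that(1)] that unfolding schmidt_def by blast
  have ox: "cinner m (x t k) (x t k') = 0" and oy: "cinner n (y t k) (y t k') = 0"
    if "t \<in> T" "k < K t" "k' < K t" "k \<noteq> k'" for t k k'
    using xy[OF that(1)] that unfolding schmidt_def by blast+
  define I where "I = Sigma T (\<lambda>t. {..<K t} \<times> {..<K t})"
  \<comment> \<open>The weight \<open>p t\<close> is put into the left factor; being nonnegative, it
    comes out of the square root unchanged.\<close>
  define P where "P = (\<lambda>(t, k, k') i i'. complex_of_real (p t) * (x t k i * cnj (x t k' i')))"
  define Q where "Q = (\<lambda>(t :: 't, k, k') j j'. y t k j * cnj (y t k' j'))"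
  have sumI: "(\<Sum>\<tau>\<in>I. f \<tau>) = (\<Sum>t\<in>T. \<Sum>k<K t. \<Sum>k'<K t. f (t, k, k'))" for f :: "_ \<Rightarrow> 'b :: comm_monoid_add"
    using sum.Sigma[of T "\<lambda>t. {..<K t} \<times> {..<K t}" "\<lambda>t kk. f (t, kk)"] T
    by (simp add: I_def sum.cartesian_product split_def)
  have Z: "Z $$ (i * n + j, i' * n + j') = (\<Sum>\<tau>\<in>I. P \<tau> i i' * Q \<tau> j j')"
    if "i < m" "j < n" "i' < m" "j' < n" for i j i' j'
  proof -
    have "Z $$ (i * n + j, i' * n + j') =
        (\<Sum>t\<in>T. complex_of_real (p t) * (\<phi> t (i * n + j) * cnj (\<phi> t (i' * n + j'))))"
      using that by (simp add: entries mult_add_less)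
    also have "\<dots> = (\<Sum>t\<in>T. \<Sum>k<K t. \<Sum>k'<K t. P (t, k, k') i i' * Q (t, k, k') j j')"
    proof (rule sum.cong[OF refl])
      fix t assume t: "t \<in> T"
      have "\<phi> t (i * n + j) * cnj (\<phi> t (i' * n + j')) =
          (\<Sum>k<K t. \<Sum>k'<K t. (x t k i * y t k j) * cnj (x t k' i' * y t k' j'))"
        using that by (simp add: dec[OF t] sum_product)
      then show "complex_of_real (p t) * (\<phi> t (i * n + j) * cnj (\<phi> t (i' * n + j'))) =
          (\<Sum>k<K t. \<Sum>k'<K t. P (t, k, k') i i' * Q (t, k, k') j j')"
        by (simp add: P_def Q_def sum_distrib_left mult_ac)
    qed
    finally show ?thesis by (simp add: sumI)
  qed
  have trP: "(\<Sum>i<m. P (t, k, k') i i) = complex_of_real (p t) * cinner m (x t k) (x t k')" for t k k'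
    by (simp add: P_def cinner_def sum_distrib_left)
  have trQ: "(\<Sum>j<n. Q (t, k, k') j j) = cinner n (y t k) (y t k')" for t k k'
    by (simp add: Q_def cinner_def)
  have nP: "(\<Sum>i<m. \<Sum>i'<m. (cmod (P (t, k, k') i i'))\<^sup>2) =
      (p t)\<^sup>2 * (l2norm m (x t k) * l2norm m (x t k'))\<^sup>2" for t k k'
    unfolding l2norm_mult_sq sum_distrib_left by (simp add: P_def norm_mult power_mult_distrib)
  have nQ: "(\<Sum>j<n. \<Sum>j'<n. (cmod (Q (t, k, k') j j'))\<^sup>2) = (l2norm n (y t k) * l2norm n (y t k'))\<^sup>2" for t k k'
    unfolding l2norm_mult_sq by (simp add: Q_def norm_mult power_mult_distrib)
  have cin1: "(\<Sum>k<K t. \<Sum>k'<K t. cinner m (x t k) (x t k') * cinner n (y t k) (y t k')) = 1"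
    if t: "t \<in> T" for t
  proof -
    have "cinner (m * n) (\<phi> t) (\<phi> t) =
        (\<Sum>k<K t. \<Sum>k'<K t. cinner m (x t k) (x t k') * cinner n (y t k) (y t k'))"
      by (rule cinner_tensor_sum) (rule dec[OF t])
    then show ?thesis by (simp add: cinner_self unit t)
  qed
  have "(\<Sum>\<tau>\<in>I. (\<Sum>i<m. P \<tau> i i) * (\<Sum>j<n. Q \<tau> j j)) = (\<Sum>t\<in>T. complex_of_real (p t) *
      (\<Sum>k<K t. \<Sum>k'<K t. cinner m (x t k) (x t k') * cinner n (y t k) (y t k')))"
    unfolding sumI trP trQ by (simp add: sum_distrib_left mult.assoc)
  also have "\<dots> = complex_of_real (\<Sum>t\<in>T. p t)"
    by (simp add: cin1)
  finally have tr: "(\<Sum>\<tau>\<in>I. (\<Sum>i<m. P \<tau> i i) * (\<Sum>j<n. Q \<tau> j j)) = 1"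
    by (simp add: p)
  let ?B = "\<lambda>n (z :: nat \<Rightarrow> nat \<Rightarrow> complex) c k k'. sqrt (c * (cmod (cinner n (z k) (z k')))\<^sup>2 + (l2norm n (z k) * l2norm n (z k'))\<^sup>2)"
  have "trace_norm (M_mat \<alpha> \<beta> l m n Z) \<le> (\<Sum>\<tau>\<in>I.
         sqrt (real l * (cmod (complex_of_real \<alpha> * (\<Sum>i<m. P \<tau> i i)))\<^sup>2 + (\<Sum>i<m. \<Sum>i'<m. (cmod (P \<tau> i i'))\<^sup>2)) *
         sqrt (real l * (cmod (complex_of_real \<beta> * (\<Sum>j<n. Q \<tau> j j)))\<^sup>2 + (\<Sum>j<n. \<Sum>j'<n. (cmod (Q \<tau> j j'))\<^sup>2)))"
    by (rule trace_norm_M_mat_le[OF Z tr])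
  also have "\<dots> = (\<Sum>t\<in>T. p t * (\<Sum>k<K t. \<Sum>k'<K t.
      ?B m (x t) (real l * \<alpha>\<^sup>2) k k' * ?B n (y t) (real l * \<beta>\<^sup>2) k k'))"
  proof -
    have sqP: "sqrt (real l * (cmod (complex_of_real \<alpha> * (complex_of_real (p t) * cinner m (x t k) (x t k'))))\<^sup>2 +
        (p t)\<^sup>2 * (l2norm m (x t k) * l2norm m (x t k'))\<^sup>2) = p t * ?B m (x t) (real l * \<alpha>\<^sup>2) k k'"
      if "t \<in> T" for t k k'
    proof -
      have "real l * (cmod (complex_of_real \<alpha> * (complex_of_real (p t) * cinner m (x t k) (x t k'))))\<^sup>2 +
        (p t)\<^sup>2 * (l2norm m (x t k) * l2norm m (x t k'))\<^sup>2 =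
        (p t)\<^sup>2 * (real l * \<alpha>\<^sup>2 * (cmod (cinner m (x t k) (x t k')))\<^sup>2 + (l2norm m (x t k) * l2norm m (x t k'))\<^sup>2)"
        by (simp add: norm_mult power_mult_distrib algebra_simps)
      then show ?thesis using p(1)[OF that] by (simp add: real_sqrt_mult)
    qed
    have sqQ: "sqrt (real l * (cmod (complex_of_real \<beta> * cinner n (y t k) (y t k')))\<^sup>2 +
        (l2norm n (y t k) * l2norm n (y t k'))\<^sup>2) = ?B n (y t) (real l * \<beta>\<^sup>2) k k'" for t k k'
      by (simp add: norm_mult power_mult_distrib mult.assoc)
    show ?thesis
      unfolding sumI trP trQ nP nQ sqQ
      unfolding sum_distrib_left
      by (intro sum.cong refl) (simp only: sqP mult.assoc)
  qed
  also have "\<dots> \<le> (\<Sum>t\<in>T. p t * (sqrt ((real l * \<alpha>\<^sup>2 + 1) * (real l * \<beta>\<^sup>2 + 1)) + (real (K t) - 1)))"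
  proof (intro sum_mono mult_left_mono p)
    fix t assume t: "t \<in> T"
    \<comment> \<open>Orthogonality reduces the double sum of \<open>cin1\<close> to its diagonal:
      the squared Schmidt coefficients add up to one.\<close>
    have "complex_of_real (\<Sum>k<K t. (l2norm m (x t k) * l2norm n (y t k))\<^sup>2) =
        (\<Sum>k<K t. cinner m (x t k) (x t k) * cinner n (y t k) (y t k))"
      by (simp add: cinner_self power_mult_distrib)
    also have "\<dots> = (\<Sum>k<K t. \<Sum>k'<K t. if k' = k then cinner m (x t k) (x t k) * cinner n (y t k) (y t k) else 0)"
      by simp
    also have "\<dots> = (\<Sum>k<K t. \<Sum>k'<K t. cinner m (x t k) (x t k') * cinner n (y t k) (y t k'))"
      using ox[OF t] by (intro sum.cong) auto
    finally have "complex_of_real (\<Sum>k<K t. (l2norm m (x t k) * l2norm n (y t k))\<^sup>2) = complex_of_real 1"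
      by (simp add: cin1[OF t])
    then have "(\<Sum>k<K t. (l2norm m (x t k) * l2norm n (y t k))\<^sup>2) = 1"
      unfolding of_real_eq_iff .
    then show "(\<Sum>k<K t. \<Sum>k'<K t. ?B m (x t) (real l * \<alpha>\<^sup>2) k k' * ?B n (y t) (real l * \<beta>\<^sup>2) k k')
        \<le> sqrt ((real l * \<alpha>\<^sup>2 + 1) * (real l * \<beta>\<^sup>2 + 1)) + (real (K t) - 1)"
      using ox[OF t] oy[OF t] by (intro schmidt_terms_le) auto
  qed
  finally show ?thesis .
qed

section \<open>Existence of Schmidt decompositions\<close>

lemma schmidt_tensor:
  assumes "\<And>i j. i < m \<Longrightarrow> j < n \<Longrightarrow> \<phi> (i * n + j) = a i * b j"
  shows "\<exists>x y. schmidt m n 1 \<phi> x y"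
  by (rule exI[of _ "\<lambda>_. a"], rule exI[of _ "\<lambda>_. b"]) (simp add: schmidt_def assms)

text \<open>Read \<phi> as an m by n matrix \<open>F\<close> and let \<open>U\<close> diagonalise
  \<open>F * mat_adjoint F\<close>. The rows of \<open>Y = mat_adjoint U * F\<close> are then
  orthogonal, and \<open>F = U * Y\<close> expands \<phi> in columns of \<open>U\<close> and rows of
  \<open>Y\<close>. The number of terms is the dimension of the left factor, whatever
  \<open>n\<close> is.\<close>

theorem schmidt_decomposition: "\<exists>x y. schmidt m n m \<phi> x y"
proof -
  define F where "F = mat m n (\<lambda>(i, j). \<phi> (i * n + j))"
  have Fc: "F \<in> carrier_mat m n" "mat_adjoint F \<in> carrier_mat n m" by (auto simp: F_def)
  obtain U d where U: "unitary m U"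
    and d: "mat_adjoint U * (F * mat_adjoint F) * U = mat m m (\<lambda>(i, j). if i = j then d i else 0)"
    using hermitian_spectral[of "F * mat_adjoint F" m] Fc by (auto simp: mat_adjoint_mult)
  have Uc: "U \<in> carrier_mat m m" "mat_adjoint U \<in> carrier_mat m m" and UU: "mat_adjoint U * U = 1\<^sub>m m"
    using U by (auto simp: unitary_def)
  define Y where "Y = mat_adjoint U * F"
  have Yc: "Y \<in> carrier_mat m n" "mat_adjoint Y \<in> carrier_mat n m" using Uc Fc by (auto simp: Y_def)
  have "Y * mat_adjoint Y = mat_adjoint U * (F * mat_adjoint F) * U"
    using Uc Fc by (simp add: Y_def mat_adjoint_mult assoc_mult_mat[of _ m m _ n _ m] assoc_mult_mat[of _ m m _ m _ m]
        assoc_mult_mat[of _ m n _ m _ m] mult_carrier_mat[of _ n m _ m] mult_carrier_mat[of _ m n _ m])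
  then have YY: "Y * mat_adjoint Y = mat m m (\<lambda>(i, j). if i = j then d i else 0)" by (simp add: d)
  have "U * Y = U * mat_adjoint U * F" using assoc_mult_mat[OF Uc Fc(1)] by (simp add: Y_def)
  then have UY: "U * Y = F" using Fc by (simp add: unitary_right[OF U])
  show ?thesis
    unfolding schmidt_def
  proof (rule exI[of _ "\<lambda>k i. U $$ (i, k)"], rule exI[of _ "\<lambda>k j. Y $$ (k, j)"], intro conjI allI impI)
    fix i j assume ij: "i < m" "j < n"
    then have "\<phi> (i * n + j) = (U * Y) $$ (i, j)" unfolding UY by (simp add: F_def)
    also have "\<dots> = (\<Sum>k<m. U $$ (i, k) * Y $$ (k, j))"
      using ij Uc Yc by (subst index_mult_mat_sum) auto
    finally show "\<phi> (i * n + j) = (\<Sum>k<m. U $$ (i, k) * Y $$ (k, j))" .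
  next
    fix k k' assume k: "k < m" "k' < m" "k \<noteq> k'"
    have "cinner m (\<lambda>i. U $$ (i, k)) (\<lambda>i. U $$ (i, k')) = (mat_adjoint U * U) $$ (k', k)"
      using k Uc by (simp add: cinner_def index_mult_mat_sum mult.commute del: index_mult_mat(1))
    then show "cinner m (\<lambda>i. U $$ (i, k)) (\<lambda>i. U $$ (i, k')) = 0" using k by (simp add: UU)
  next
    fix k k' assume k: "k < m" "k' < m" "k \<noteq> k'"
    have "cinner n (\<lambda>j. Y $$ (k, j)) (\<lambda>j. Y $$ (k', j)) = (Y * mat_adjoint Y) $$ (k, k')"
      using k Yc by (simp add: cinner_def index_mult_mat_sum del: index_mult_mat(1))
    then show "cinner n (\<lambda>j. Y $$ (k, j)) (\<lambda>j. Y $$ (k', j)) = 0" using k by (simp add: YY)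
  qed
qed

section \<open>Biseparable states\<close>

lemma decode_triple:
  fixes a b c d :: nat
  assumes "a < d" "b < d" "c < d"
  defines "r \<equiv> a * (d * d) + b * d + c"
  shows "r div (d * d) = a" "(r div d) mod d = b" "r mod d = c" "r < d * d * d"
proof -
  have bc: "b * d + c < d * d" by (rule mult_add_less) fact+
  have r: "r = a * (d * d) + (b * d + c)" by (simp add: r_def)
  have "r div (d * d) = (b * d + c) div (d * d) + a"
    unfolding r using assms(1) by (subst div_mult_self3) auto
  then show "r div (d * d) = a" using bc by simp
  have "r = (a * d + b) * d + c" by (simp add: r_def algebra_simps)
  then show "(r div d) mod d = b" "r mod d = c" using assms(2,3) by auto
  show "r < d * d * d"
    unfolding r using mult_add_less[OF assms(1) bc] by (simp add: mult.assoc)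
qed

lemma encode_triple:
  fixes d r :: nat
  assumes "r < d * d * d"
  obtains a b c where "a < d" "b < d" "c < d" "r = a * (d * d) + b * d + c"
proof
  have d: "0 < d" using assms by (cases d) auto
  show "r div (d * d) < d" using assms by (simp add: less_mult_imp_div_less mult.assoc)
  show "(r div d) mod d < d" "r mod d < d" using d by auto
  have "r = r div d div d * d * d + r div d mod d * d + r mod d"
    by (metis add_mult_distrib div_mult_mod_eq)
  then show "r = r div (d * d) * (d * d) + (r div d) mod d * d + r mod d"
    by (simp add: div_mult2_eq mult.assoc)
qed

text \<open>On base \<open>d\<close> digits this exchanges the leading two, so it is its own
  inverse.\<close>

lemma bij_betw_from_213: "bij_betw (from_213 d d d) {..<d * d * d} {..<d * d * d}"
proof -
  have eq: "from_213 d d d (a * (d * d) + b * d + c) = b * (d * d) + a * d + c"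
    if "a < d" "b < d" "c < d" for a b c
    using decode_triple(1-3)[OF that] by (simp add: from_213_def Let_def)
  have "from_213 d d d (from_213 d d d r) = r" if "r < d * d * d" for r
    using that by (rule encode_triple) (simp add: eq)
  moreover have "from_213 d d d r < d * d * d" if "r < d * d * d" for r
    using that by (rule encode_triple) (simp add: eq decode_triple(4))
  ultimately show ?thesis
    by (intro bij_betw_byWitness[where f' = "from_213 d d d"]) auto
qed

text \<open>On base \<open>d\<close> digits this is a cyclic shift of order three, so its inverse is
  its square.\<close>

lemma bij_betw_from_312: "bij_betw (from_312 d d d) {..<d * d * d} {..<d * d * d}"
proof -
  let ?f = "from_312 d d d"
  have eq: "?f (a * (d * d) + b * d + c) = b * (d * d) + c * d + a"
    if "a < d" "b < d" "c < d" for a b c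
    using decode_triple(1-3)[OF that] by (simp add: from_312_def Let_def)
  have "?f (?f (?f r)) = r" if "r < d * d * d" for r
    using that by (rule encode_triple) (simp add: eq)
  moreover have "?f r < d * d * d" if "r < d * d * d" for r
    using that by (rule encode_triple) (simp add: eq decode_triple(4))
  ultimately show ?thesis
    by (intro bij_betw_byWitness[where f' = "\<lambda>r. ?f (?f r)"]) auto
qed

section \<open>The bound for one cut and the average over the cuts\<close>

lemma l2norm_bij:
  "bij_betw \<sigma> {..<n} {..<n} \<Longrightarrow> l2norm n (\<lambda>r. f (\<sigma> r)) = l2norm n f"
  unfolding l2norm_def L2_set_def
  using sum.reindex_bij_betw[of \<sigma> "{..<n}" "{..<n}" "\<lambda>r. (cmod (f r))\<^sup>2"] by simp

lemma l2norm_unit_vector: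
  assumes "v \<in> carrier_vec n" "unit_vector v"
  shows "l2norm n (\<lambda>r. v $ r) = 1"
proof -
  have "complex_of_real ((l2norm n (\<lambda>r. v $ r))\<^sup>2) = complex_of_real 1"
    using assms unfolding cinner_self[symmetric]
    by (simp add: cinner_def unit_vector_def scalar_prod_def atLeast0LessThan)
  then have "(l2norm n (\<lambda>r. v $ r))\<^sup>2 = 1" unfolding of_real_eq_iff .
  then show ?thesis using l2norm_nonneg[of n "\<lambda>r. v $ r"] by (simp add: power2_eq_1_iff)
qed

lemma schmidt_is_tensor:
  assumes "is_tensor m n (reindex_vec \<sigma> v)" "v \<in> carrier_vec (m * n)"
  shows "\<exists>x y. schmidt m n 1 (\<lambda>r. v $ \<sigma> r) x y"
proof -
  obtain a b where ab: "a \<in> carrier_vec m" "b \<in> carrier_vec n" "reindex_vec \<sigma> v = tensor_vec a b"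
    using assms(1) by (auto simp: is_tensor_def)
  show ?thesis
  proof (rule schmidt_tensor)
    fix i j assume ij: "i < m" "j < n"
    have "v $ \<sigma> (i * n + j) = reindex_vec \<sigma> v $ (i * n + j)"
      using ij assms(2) by (simp add: reindex_vec_def mult_add_less)
    also have "\<dots> = a $ i * b $ j"
      unfolding ab(3) using ij ab(1,2) by (simp add: tensor_vec_def mult_add_less)
    finally show "v $ \<sigma> (i * n + j) = a $ i * b $ j" .
  qed
qed

text \<open>\<open>C\<close> marks pure states known to be products across the cut. They have a
  single Schmidt term and thus no excess; for the others the general decomposition with
  \<open>m\<close> terms allows an excess of \<open>m - 1\<close>.\<close>

lemma trace_norm_reindexed_mixture_le:
  fixes v :: "'t \<Rightarrow> complex vec" and p :: "'t \<Rightarrow> real"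
  assumes T: "finite T" and \<sigma>: "bij_betw \<sigma> {..<m * n} {..<m * n}"
    and Z: "Z \<in> carrier_mat (m * n) (m * n)"
    and entries: "\<And>r s. r < m * n \<Longrightarrow> s < m * n \<Longrightarrow>
      Z $$ (r, s) = (\<Sum>t\<in>T. complex_of_real (p t) * (v t $ r * cnj (v t $ s)))"
    and p: "\<And>t. t \<in> T \<Longrightarrow> 0 \<le> p t" "(\<Sum>t\<in>T. p t) = 1"
    and v: "\<And>t. t \<in> T \<Longrightarrow> v t \<in> carrier_vec (m * n)" "\<And>t. t \<in> T \<Longrightarrow> unit_vector (v t)"
    and tensor: "\<And>t. t \<in> T \<Longrightarrow> C t \<Longrightarrow> is_tensor m n (reindex_vec \<sigma> (v t))"
  shows "trace_norm (M_mat \<alpha> \<beta> l m n (reindex_mat \<sigma> Z)) \<le>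
    (\<Sum>t\<in>T. p t * (sqrt ((real l * \<alpha>\<^sup>2 + 1) * (real l * \<beta>\<^sup>2 + 1)) + (if C t then 0 else real m - 1)))"
proof -
  have \<sigma>': "\<sigma> r < m * n" if "r < m * n" for r using \<sigma> that by (auto simp: bij_betw_def)
  have "trace_norm (M_mat \<alpha> \<beta> l m n (reindex_mat \<sigma> Z)) \<le>
    (\<Sum>t\<in>T. p t * (sqrt ((real l * \<alpha>\<^sup>2 + 1) * (real l * \<beta>\<^sup>2 + 1)) + (real (if C t then 1 else m) - 1)))"
  proof (rule trace_norm_M_mat_mixture_le[where \<phi> = "\<lambda>t r. v t $ \<sigma> r", OF T _ p])
    show "reindex_mat \<sigma> Z $$ (r, s) = (\<Sum>t\<in>T. complex_of_real (p t) * (v t $ \<sigma> r * cnj (v t $ \<sigma> s)))"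
      if "r < m * n" "s < m * n" for r s
      using Z that by (simp add: reindex_mat_def entries \<sigma>')
    show "l2norm (m * n) (\<lambda>r. v t $ \<sigma> r) = 1" if "t \<in> T" for t
      using l2norm_bij[OF \<sigma>, of "\<lambda>r. v t $ r"] l2norm_unit_vector[OF v[OF that]] by simp
    show "\<exists>x y. schmidt m n (if C t then 1 else m) (\<lambda>r. v t $ \<sigma> r) x y" if "t \<in> T" for t
      using schmidt_is_tensor[OF tensor v(1)] schmidt_decomposition that by simp
  qed
  moreover have "real (if C t then 1 else m) - 1 = (if C t then 0 else real m - 1)" for t
    by simp
  ultimately show ?thesis by simp
qed

theorem theorem4:
  fixes d1 d2 d3 d l :: nat and \<alpha> \<beta> :: real and \<rho> :: "complex mat"
  assumes "d1 = d" and "d2 = d" and "d3 = d" and "1 \<le> d" and "1 \<le> l"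
    and "state (d1 * d2 * d3) \<rho>"
    and "biseparable d1 d2 d3 \<rho>"
  shows "M_avg \<alpha> \<beta> l d1 d2 d3 \<rho>
    \<le> sqrt ((real l * \<alpha>\<^sup>2 + 1) * (real l * \<beta>\<^sup>2 + 1)) + 2 * (real d - 1) / 3"
proof -
  note d = assms(1-3)
  \<comment> \<open>Bracketed so as to match \<open>m * n\<close> with one party of dimension
    \<open>d\<close> against two of joint dimension \<open>d * d\<close>.\<close>
  let ?N = "d * (d * d)"
  obtain n1 n2 n3 p1 p2 p3 \<phi>1 \<phi>2 \<phi>3 where
    1: "\<forall>i<n1. 0 \<le> p1 i \<and> pure_1_23 d d d (\<phi>1 i)" and
    2: "\<forall>j<n2. 0 \<le> p2 j \<and> pure_2_13 d d d (\<phi>2 j)" and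
    3: "\<forall>k<n3. 0 \<le> p3 k \<and> pure_3_12 d d d (\<phi>3 k)" and
    p: "(\<Sum>i<n1. p1 i) + (\<Sum>j<n2. p2 j) + (\<Sum>k<n3. p3 k) = (1 :: real)" and
    \<rho>: "\<rho> = mixture (d * d * d) n1 p1 \<phi>1 + mixture (d * d * d) n2 p2 \<phi>2 + mixture (d * d * d) n3 p3 \<phi>3"
    using assms(7) unfolding biseparable_def d by blast
  \<comment> \<open>The three sums become one family; the tag records the cut across which the state
    is a product.\<close>
  define T where "T = (\<lambda>i. (1 :: nat, i)) ` {..<n1} \<union> (\<lambda>i. (2, i)) ` {..<n2} \<union> (\<lambda>i. (3, i)) ` {..<n3}"
  define q where "q = (\<lambda>(c :: nat, i). if c = 1 then p1 i else if c = 2 then p2 i else p3 i)"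
  define v where "v = (\<lambda>(c :: nat, i). if c = 1 then \<phi>1 i else if c = 2 then \<phi>2 i else \<phi>3 i)"
  have T: "finite T" by (simp add: T_def)
  have sumT: "(\<Sum>t\<in>T. f t) = (\<Sum>i<n1. f (1, i)) + (\<Sum>i<n2. f (2, i)) + (\<Sum>i<n3. f (3, i))"
    for f :: "nat \<times> nat \<Rightarrow> 'b :: comm_monoid_add"
    unfolding T_def by (subst sum.union_disjoint; (subst sum.union_disjoint)?)
      (auto simp: sum.reindex inj_on_def)
  have Z: "\<rho> \<in> carrier_mat ?N ?N" by (simp add: \<rho> mixture_def mult.assoc)
  have entries: "\<rho> $$ (r, s) = (\<Sum>t\<in>T. complex_of_real (q t) * (v t $ r * cnj (v t $ s)))"
    if "r < ?N" "s < ?N" for r s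
    unfolding sumT using that by (simp add: \<rho> mixture_def mult.assoc q_def v_def)
  have q: "0 \<le> q t" and v: "v t \<in> carrier_vec ?N" "unit_vector (v t)" if "t \<in> T" for t
    using that 1 2 3
    by (auto simp: T_def q_def v_def pure_1_23_def pure_2_13_def pure_3_12_def mult.assoc)
  have q1: "(\<Sum>t\<in>T. q t) = 1" unfolding sumT using p by (simp add: q_def)
  define S where "S = sqrt ((real l * \<alpha>\<^sup>2 + 1) * (real l * \<beta>\<^sup>2 + 1))"
  have cut: "trace_norm (M_mat \<alpha> \<beta> l d (d * d) (reindex_mat \<sigma> \<rho>)) \<le>
      (\<Sum>t\<in>T. q t * (S + (if fst t = c then 0 else real d - 1)))"
    if "bij_betw \<sigma> {..<d * d * d} {..<d * d * d}"
      and "\<And>t. t \<in> T \<Longrightarrow> fst t = c \<Longrightarrow> is_tensor d (d * d) (reindex_vec \<sigma> (v t))" for \<sigma> c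
    unfolding S_def
    by (rule trace_norm_reindexed_mixture_le[OF T _ Z entries q q1 v])
       (use that in \<open>auto simp: mult.assoc\<close>)
  \<comment> \<open>The first cut keeps the given order of the factors and is treated as a
    reindexing by the identity.\<close>
  have "reindex_mat id \<rho> = \<rho>" using Z by (intro eq_matI) (auto simp: reindex_mat_def)
  moreover have "reindex_vec id w = w" for w by (intro eq_vecI) (auto simp: reindex_vec_def)
  then have "trace_norm (M_mat \<alpha> \<beta> l d (d * d) (reindex_mat id \<rho>)) \<le>
      (\<Sum>t\<in>T. q t * (S + (if fst t = 1 then 0 else real d - 1)))"
    using 1 by (intro cut) (auto simp: T_def v_def pure_1_23_def)
  ultimately have M1: "trace_norm (M_1_23 \<alpha> \<beta> l d d d \<rho>) \<le>
      (\<Sum>t\<in>T. q t * (S + (if fst t = 1 then 0 else real d - 1)))"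
    by (simp add: M_1_23_def)
  have M2: "trace_norm (M_2_13 \<alpha> \<beta> l d d d \<rho>) \<le> (\<Sum>t\<in>T. q t * (S + (if fst t = 2 then 0 else real d - 1)))"
    unfolding M_2_13_def using 2
    by (intro cut bij_betw_from_213) (auto simp: T_def v_def pure_2_13_def)
  have M3: "trace_norm (M_3_12 \<alpha> \<beta> l d d d \<rho>) \<le> (\<Sum>t\<in>T. q t * (S + (if fst t = 3 then 0 else real d - 1)))"
    unfolding M_3_12_def using 3
    by (intro cut bij_betw_from_312) (auto simp: T_def v_def pure_3_12_def)
  have "trace_norm (M_1_23 \<alpha> \<beta> l d d d \<rho>) + trace_norm (M_2_13 \<alpha> \<beta> l d d d \<rho>) + trace_norm (M_3_12 \<alpha> \<beta> l d d d \<rho>)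
      \<le> (\<Sum>t\<in>T. q t * (S + (if fst t = 1 then 0 else real d - 1)) + q t * (S + (if fst t = 2 then 0 else real d - 1))
          + q t * (S + (if fst t = 3 then 0 else real d - 1)))"
    unfolding sum.distrib using M1 M2 M3 by linarith
  \<comment> \<open>Every tag agrees with exactly one of the three cuts, so each state pays the
    excess \<open>d - 1\<close> exactly twice.\<close>
  also have "\<dots> = (\<Sum>t\<in>T. q t * (3 * S + 2 * (real d - 1)))"
    by (intro sum.cong refl) (auto simp: T_def algebra_simps)
  also have "\<dots> = 3 * S + 2 * (real d - 1)"
    by (simp add: q1 flip: sum_distrib_right)
  finally show ?thesis
    unfolding M_avg_def d S_def[symmetric] by (simp add: field_simps)
qed

end
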